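(* If there exists a torsion-free abelian countably compact Hausdorff topological group without non-trivial convergent sequences, then there exists a Tychonoff countably compact topological semigroup containing a subsemigroup isomorphic to the bicyclic semigroup $\mathcal C(p,q)$.
   Context: The bicyclic semigroup $\mathcal C(p,q)$ is the semigroup with identity generated by $p,q$ subject to the single relation $qp=1$. A non-trivial convergent sequence is a convergent sequence that is not eventually constant. *)

theory Defs
  imports "HOL-Analysis.Analysis"
begin

definition torsion_free :: "'a::ab_group_add itself \<Rightarrow> bool" where
  "torsion_free _ \<longleftrightarrow> (\<forall>(x::'a) (n::nat). n > 0 \<and> (\<Sum>i<n. x) = 0 \<longrightarrow> x = 0)"

definition nontrivial_convergent_seq :: "(nat \<Rightarrow> 'a::topological_space) \<Rightarrow> bool" where
  "nontrivial_convergent_seq s \<longleftrightarrow>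
     (\<exists>l. s \<longlonglongrightarrow> l) \<and> \<not> (\<exists>c. \<forall>\<^sub>F n in sequentially. s n = c)"

definition countably_compact_space :: "'a topology \<Rightarrow> bool" where
  "countably_compact_space T \<longleftrightarrow>
     (\<forall>U. countable U \<and> (\<forall>u\<in>U. openin T u) \<and> topspace T \<subseteq> \<Union>U \<longrightarrow>
          (\<exists>F\<subseteq>U. finite F \<and> topspace T \<subseteq> \<Union>F))"

definition tychonoff_space :: "'a topology \<Rightarrow> bool" where
  "tychonoff_space T \<longleftrightarrow> completely_regular_space T \<and> t1_space T"

definition topological_semigroup :: "'a set \<Rightarrow> ('a \<Rightarrow> 'a \<Rightarrow> 'a) \<Rightarrow> 'a topology \<Rightarrow> bool" where
  "topological_semigroup S f T \<longleftrightarrow>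
     topspace T = S \<and>
     (\<forall>x\<in>S. \<forall>y\<in>S. f x y \<in> S) \<and>
     (\<forall>x\<in>S. \<forall>y\<in>S. \<forall>z\<in>S. f (f x y) z = f x (f y z)) \<and>
     continuous_map (prod_topology T T) T (\<lambda>(x, y). f x y)"

text \<open>The bicyclic semigroup C(p,q), in its standard normal form: every element is uniquely
  q^i p^j, represented by (i,j); using qp = 1 one gets
  q^a p^b * q^c p^d = q^(a + c - min b c) p^(b + d - min b c).\<close>
definition bicyclic_mult :: "nat \<times> nat \<Rightarrow> nat \<times> nat \<Rightarrow> nat \<times> nat" where
  "bicyclic_mult x y = (case x of (a, b) \<Rightarrow> case y of (c, d) \<Rightarrow>
      (a + c - min b c, b + d - min b c))"

end

theory Submission
  imports Defs
begin

text \<open>Fix \<^term>\<open>x \<noteq> 0\<close> in the group \<open>G\<close> and map the bicyclic semigroup to \<open>G\<close> by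
  \<open>q\<^sup>i p\<^sup>j \<mapsto> (i - j) x\<close>. Because \<open>G\<close> has no non-trivial convergent sequences, every infinite subset has at
  least continuum many limit points, while the pure subgroup generated by fewer than continuum many
  elements has fewer than continuum many elements. A transfinite recursion of length continuum
  therefore picks generators that are independent of \<open>x\<close> and of each other and that include a limit
  point of every infinite set of combinations of \<open>x\<close> and the generators. The nonempty sums of
  generators, shifted by multiples of \<open>x\<close>, form a semigroup \<open>R\<close> that is invariant under \<open>\<int>x\<close> and
  disjoint from it, and every infinite subset of \<open>R \<union> \<int>x\<close> has a limit point in \<open>R\<close>.

  The space is the disjoint union of the bicyclic semigroup, \<open>\<int>x\<close> and \<open>R\<close>. An injective
  sequence of constant degree \<open>i - j\<close> converges to the point \<open>(i - j) x\<close> of \<open>\<int>x\<close>, and a sequence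
  of distinct degrees accumulates in \<open>R\<close> only. Since
  \<open>R\<close> is an ideal missing \<open>\<int>x\<close>, the relation \<open>qp = 1\<close> does not obstruct continuity there.\<close>

section \<open>Pure subgroups and cardinality\<close>

unbundle cardinal_syntax

definition nmul :: "nat \<Rightarrow> 'a::comm_monoid_add \<Rightarrow> 'a" where
  "nmul n x = (\<Sum>i<n. x)"

lemma nmul_0 [simp]: "nmul 0 x = 0"
  by (simp add: nmul_def)

lemma nmul_Suc: "nmul (Suc n) x = nmul n x + x"
  by (simp add: nmul_def)

lemma nmul_add: "nmul (m + n) x = nmul m x + nmul n x"
  by (induction n) (simp_all add: nmul_Suc add.assoc)

lemma nmul_diff: "nmul n (x - y) = nmul n x - nmul n (y::'a::ab_group_add)"
  by (simp add: nmul_def sum_subtractf)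

lemma torsion_free_nmul_eq_0:
  "torsion_free TYPE('a::ab_group_add) \<Longrightarrow> nmul n (x::'a) = 0 \<Longrightarrow> n = 0 \<or> x = 0"
  by (auto simp: torsion_free_def nmul_def)

lemma torsion_free_nmul_inject:
  assumes "torsion_free TYPE('a::ab_group_add)" "n > 0" "nmul n x = nmul n (y::'a)"
  shows "x = y"
  using torsion_free_nmul_eq_0[OF assms(1), of n "x - y"] assms(2,3) by (simp add: nmul_diff)

lemma torsion_free_inj_nmul:
  assumes tf: "torsion_free TYPE('a::ab_group_add)" and x: "(x::'a) \<noteq> 0"
  shows "inj (\<lambda>n. nmul n x)"
proof (rule injI)
  have "m = n" if "m \<le> n" "nmul m x = nmul n x" for m n
    using torsion_free_nmul_eq_0[OF tf, of "n - m" x] nmul_add[of m "n - m" x] that x by simp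
  then show "m = n" if "nmul m x = nmul n x" for m n
    using that by (metis nat_le_linear)
qed

text \<open>For nonempty \<open>B\<close> this is the pure subgroup generated by \<open>B\<close>:
  differences already yield zero, negatives and sums, and \<open>root\<close> closes under division.
  Over the empty set it is empty, so \<open>pure_hull_0\<close> asks for a member of
  \<open>B\<close>.\<close>

inductive_set pure_hull :: "'a::ab_group_add set \<Rightarrow> 'a set" for B where
  base: "b \<in> B \<Longrightarrow> b \<in> pure_hull B"
| diff: "\<lbrakk>a \<in> pure_hull B; b \<in> pure_hull B\<rbrakk> \<Longrightarrow> a - b \<in> pure_hull B"
| root: "\<lbrakk>nmul n a \<in> pure_hull B; n > 0\<rbrakk> \<Longrightarrow> a \<in> pure_hull B"

lemma pure_hull_0: "b \<in> B \<Longrightarrow> 0 \<in> pure_hull B"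
  using pure_hull.diff[of b B b] by (simp add: pure_hull.base)

lemma pure_hull_add:
  assumes "a \<in> pure_hull B" "b \<in> pure_hull B"
  shows "a + b \<in> pure_hull B"
proof -
  have "a - (a - a - b) \<in> pure_hull B"
    using assms by (blast intro: pure_hull.diff)
  then show ?thesis by simp
qed

lemma pure_hull_nmul: "b \<in> pure_hull B \<Longrightarrow> nmul n b \<in> pure_hull B"
proof (induction n)
  case 0
  then show ?case using pure_hull.diff[of b B b] by simp
qed (simp add: nmul_Suc pure_hull_add)

text \<open>Countably many stages exhaust the hull. One stage adds the differences, indexed by
  \<open>A \<times> A\<close>, and for each positive \<open>n\<close> the preimage of
  \<open>A\<close> under \<open>nmul n\<close>, which torsion-freeness embeds into \<open>A\<close>.
  None of this exceeds an infinite bound \<open>|K|\<close>.\<close>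

lemma pure_hull_card_le:
  fixes B :: "'a::ab_group_add set" and K :: "'k set"
  assumes tf: "torsion_free TYPE('a)" and K: "infinite K" and B: "|B| \<le>o |K|"
  shows "|pure_hull B| \<le>o |K|"
proof -
  define step :: "'a set \<Rightarrow> 'a set" where
    "step A = (A \<union> (\<lambda>(a, b). a - b) ` (A \<times> A)) \<union> (\<Union>n\<in>{0<..}. nmul n -` A)" for A
  define st where "st n = (step ^^ n) B" for n
  have N: "|I| \<le>o |K|" for I :: "nat set"
    using K by (meson card_of_mono1 infinite_iff_card_of_nat ordLeq_transitive top_greatest)
  have step: "|step A| \<le>o |K|" if A: "|A| \<le>o |K|" for A
  proof -
    have 1: "|(\<lambda>(a, b). a - b) ` (A \<times> A)| \<le>o |K|"
      by (rule ordLeq_transitive[OF card_of_image])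
        (use K A in \<open>auto intro!: card_of_Times_ordLeq_infinite_Field simp: Field_card_of card_of_card_order_on\<close>)
    have 2: "|nmul n -` A| \<le>o |K|" if "n > 0" for n
    proof (rule ordLeq_transitive[OF _ A], rule card_of_ordLeqI)
      show "inj_on (nmul n) (nmul n -` A)"
        using torsion_free_nmul_inject[OF tf that] by (auto intro!: inj_onI)
    qed auto
    have 3: "|\<Union>n\<in>{0<..}. nmul n -` A| \<le>o |K|"
      by (rule card_of_UNION_ordLeq_infinite[OF K N]) (use 2 in auto)
    show ?thesis
      unfolding step_def
      by (intro card_of_Un_ordLeq_infinite_Field) (use 1 3 A K in \<open>auto simp: Field_card_of card_of_card_order_on\<close>)
  qed
  have st: "|st n| \<le>o |K|" for n
    by (induction n) (simp_all add: st_def B step)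
  have st_Suc: "st (Suc n) = step (st n)" for n
    by (simp add: st_def)
  have mono: "m \<le> n \<Longrightarrow> st m \<subseteq> st n" for m n
    by (rule lift_Suc_mono_le[of st]) (auto simp: st_Suc step_def)
  have sub: "a \<in> (\<Union>n. st n)" if "a \<in> pure_hull B" for a
    using that
  proof induction
    case (base b)
    then have "b \<in> st 0" by (simp add: st_def)
    then show ?case by blast
  next
    case (diff a b)
    then obtain m n where mn: "a \<in> st m" "b \<in> st n" by blast
    then have "a \<in> st (max m n)" "b \<in> st (max m n)"
      using mono[of m "max m n"] mono[of n "max m n"] by auto
    then have "a - b \<in> st (Suc (max m n))"
      unfolding st_Suc step_def by force
    then show ?case by blast
  next
    case (root n a)
    then obtain m where "nmul n a \<in> st m" by blast
    with root have "a \<in> st (Suc m)"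
      unfolding st_Suc step_def by auto
    then show ?case by blast
  qed
  have "|\<Union>n. st n| \<le>o |K|"
    by (rule card_of_UNION_ordLeq_infinite[OF K N]) (use st in auto)
  with sub show ?thesis
    by (meson card_of_mono1 ordLeq_transitive subsetI)
qed

text \<open>Koenig: a countable subset of the continuum, well-ordered in its initial order type, is
  bounded, and in fact by a value of any prescribed injection.\<close>
lemma countable_bounded_by_inj:
  fixes \<iota> :: "(nat \<Rightarrow> nat) \<Rightarrow> nat \<Rightarrow> nat"
  defines "r \<equiv> |UNIV :: (nat \<Rightarrow> nat) set|"
  assumes B: "countable B" and inj: "inj \<iota>"
  shows "\<exists>\<beta>. B \<subseteq> underS r (\<iota> \<beta>)"
proof (cases "B = {}")
  case False
  then obtain b :: "nat \<Rightarrow> nat \<Rightarrow> nat" where b: "range b = B"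
    using B by (metis range_from_nat_into)
  have F: "Field r = UNIV" and co: "Card_order r"
    by (simp_all add: r_def Field_card_of card_of_card_order_on)
  have inf: "infinite (UNIV :: (nat \<Rightarrow> nat) set)"
    using finite_fun_UNIVD2 by force
  show ?thesis
  proof (rule ccontr)
    assume no: "\<not> ?thesis"
    \<comment> \<open>If no value of \<open>\<iota>\<close> bounds \<open>B\<close>, the sets
      \<open>J n\<close> cover all parameters. Yet each is smaller than the continuum, since
      \<open>\<iota>\<close> maps it injectively into a proper initial segment.\<close>
    define J where "J n = {\<beta>. (\<iota> \<beta>, b n) \<in> r}" for n
    have tot: "(x, y) \<in> r \<or> y \<in> underS r x" for x y
      using co F unfolding card_order_on_def well_order_on_def linear_order_on_def total_on_def
        partial_order_on_def preorder_on_def refl_on_def underS_def by (cases "x = y") auto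
    have J: "\<exists>n. \<beta> \<in> J n" for \<beta>
    proof -
      obtain y where "y \<in> B" "y \<notin> underS r (\<iota> \<beta>)" using no by blast
      moreover then obtain n where "y = b n" using b by blast
      ultimately show ?thesis using tot unfolding J_def by blast
    qed
    have less: "|J n| <o r" for n
    proof -
      obtain c where c: "b n \<noteq> c" "(b n, c) \<in> r"
        using infinite_Card_order_limit[OF co] F inf by auto
      have "\<iota> ` J n \<subseteq> underS r c"
        using co c unfolding card_order_on_def well_order_on_def linear_order_on_def
          partial_order_on_def preorder_on_def underS_def J_def antisym_def trans_def by blast
      then have "|J n| \<le>o |underS r c|"
        using inj by (intro card_of_ordLeqI[of \<iota>]) (auto intro: inj_on_subset)
      then show ?thesis
        using card_of_underS[OF co, of c] F ordLeq_ordLess_trans by blast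
    qed
    \<comment> \<open>Read \<open>a\<close> as a matrix whose row \<open>n\<close> is
      \<open>\<lambda>m. a (prod_encode (n, m))\<close>. The members of \<open>J n\<close> are too
      few to realise every possible row \<open>n\<close>, so some row \<open>f n\<close> is missed
      by all of them; the matrix with these rows then lies in no \<open>J n\<close>.\<close>
    have "\<exists>f. \<forall>a\<in>J n. f \<noteq> (\<lambda>m. a (prod_encode (n, m)))" for n
    proof (rule ccontr)
      assume "\<not> ?thesis"
      then have "UNIV \<subseteq> (\<lambda>a m. a (prod_encode (n, m))) ` J n" by (auto simp: image_iff)
      then have "r \<le>o |J n|"
        unfolding r_def by (metis card_of_image card_of_mono1 ordLeq_transitive)
      with less show False using not_ordLess_ordLeq by blast
    qed
    then obtain f where f: "\<And>n a. a \<in> J n \<Longrightarrow> f n \<noteq> (\<lambda>m. a (prod_encode (n, m)))" by metis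
    define a where "a k = (case prod_decode k of (n, m) \<Rightarrow> f n m)" for k
    obtain n where "a \<in> J n" using J by blast
    from f[OF this] show False by (simp add: a_def)
  qed
qed auto

section \<open>Complete regularity and limit points in topological groups\<close>

lemma continuous_add_const: "continuous_on UNIV (\<lambda>x. x + c :: 'a::topological_monoid_add)"
  by (intro continuous_intros)

text \<open>Continuity of addition at zero, used twice, gives \<open>B + B\<close> inside
  \<open>A\<close> and \<open>A + A\<close> inside \<open>U\<close>; the third summand is covered by
  \<open>B \<subseteq> A\<close>. Intersecting \<open>B\<close> with its reflection makes the
  neighbourhood symmetric.\<close>

lemma open_zero_third:
  fixes U :: "'a::topological_ab_group_add set"
  assumes "open U" "0 \<in> U"
  obtains V where "open V" "0 \<in> V" "\<And>a b c. \<lbrakk>a \<in> V; b \<in> V; c \<in> V\<rbrakk> \<Longrightarrow> a + b + c \<in> U"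
    "\<And>a. a \<in> V \<Longrightarrow> - a \<in> V"
proof -
  have half: "\<exists>V. open V \<and> 0 \<in> V \<and> (\<forall>a\<in>V. \<forall>b\<in>V. a + b \<in> W)" if W: "open W" "0 \<in> W" for W :: "'a set"
  proof -
    have "eventually (\<lambda>x. x \<in> W) (nhds (0 + 0))"
      using W by (auto simp: eventually_nhds)
    then have "eventually (\<lambda>x. fst x + snd x \<in> W) (nhds 0 \<times>\<^sub>F nhds (0::'a))"
      using tendsto_add_Pair filterlim_iff by fast
    then obtain P Q where PQ: "eventually P (nhds 0)" "eventually Q (nhds (0::'a))"
        "\<And>x y. P x \<Longrightarrow> Q y \<Longrightarrow> x + y \<in> W"
      unfolding eventually_prod_filter by auto
    then obtain A B where "open A" "0 \<in> A" "\<forall>x\<in>A. P x" "open B" "0 \<in> B" "\<forall>x\<in>B. Q x"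
      unfolding eventually_nhds by blast
    with PQ(3) show ?thesis
      by (intro exI[of _ "A \<inter> B"]) auto
  qed
  obtain A where A: "open A" "0 \<in> A" "\<And>a b. a \<in> A \<Longrightarrow> b \<in> A \<Longrightarrow> a + b \<in> U"
    using half[OF assms] by blast
  obtain B where B: "open B" "0 \<in> B" "\<And>a b. a \<in> B \<Longrightarrow> b \<in> B \<Longrightarrow> a + b \<in> A"
    using half[OF A(1,2)] by blast
  have "B \<subseteq> A"
    using B(3)[of _ 0] B(2) by auto
  have *: "open (uminus -` B)"
    using B(1) by (intro open_vimage) (auto intro!: continuous_intros)
  show ?thesis
  proof (rule that[of "B \<inter> uminus -` B"])
    fix a b c assume "a \<in> B \<inter> uminus -` B" "b \<in> B \<inter> uminus -` B" "c \<in> B \<inter> uminus -` B"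
    then show "a + b + c \<in> U"
      using A(3)[of "a + b" c] B(3) \<open>B \<subseteq> A\<close> by auto
  qed (use B * in auto)
qed

text \<open>The Birkhoff-Kakutani construction: \<^term>\<open>W\<close> is a sequence of neighbourhoods of zero, a chain
  is a finite sum of elements of the \<^term>\<open>W n\<close>, and each summand from \<^term>\<open>W n\<close> costs
  \<^term>\<open>(1/2::real) ^ n\<close>.\<close>
definition chain :: "(nat \<Rightarrow> 'a set) \<Rightarrow> ('a \<times> nat) list \<Rightarrow> bool" where
  "chain W ps \<longleftrightarrow> (\<forall>(v, n)\<in>set ps. v \<in> W n)"

definition chain_sum :: "('a \<times> nat) list \<Rightarrow> 'a::comm_monoid_add" where
  "chain_sum ps = sum_list (map fst ps)"

definition chain_cost :: "('a \<times> nat) list \<Rightarrow> real" where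
  "chain_cost ps = sum_list (map (\<lambda>p. (1 / 2) ^ snd p) ps)"

definition chain_norm :: "(nat \<Rightarrow> 'a set) \<Rightarrow> 'a::comm_monoid_add \<Rightarrow> real" where
  "chain_norm W g = Inf (chain_cost ` {ps. chain W ps \<and> chain_sum ps = g})"

lemma chain_cost_nonneg: "chain_cost ps \<ge> 0"
  by (auto simp: chain_cost_def intro!: sum_list_nonneg)

lemma chain_append [simp]: "chain W (ps @ qs) \<longleftrightarrow> chain W ps \<and> chain W qs"
  and chain_Cons [simp]: "chain W (p # ps) \<longleftrightarrow> fst p \<in> W (snd p) \<and> chain W ps"
  and chain_Nil [simp]: "chain W []"
  by (auto simp: chain_def)

lemma chain_sum_append [simp]: "chain_sum (ps @ qs) = chain_sum ps + chain_sum qs"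
  and chain_sum_Cons [simp]: "chain_sum (p # ps) = fst p + chain_sum ps"
  and chain_sum_Nil [simp]: "chain_sum [] = 0"
  by (auto simp: chain_sum_def)

lemma chain_cost_append [simp]: "chain_cost (ps @ qs) = chain_cost ps + chain_cost qs"
  and chain_cost_Cons [simp]: "chain_cost (p # ps) = (1 / 2) ^ snd p + chain_cost ps"
  and chain_cost_Nil [simp]: "chain_cost [] = 0"
  by (auto simp: chain_cost_def)

text \<open>Induction on the length. Cut at the last entry \<open>p\<close> whose preceding part
  costs less than half the bound. The part after \<open>p\<close> then also costs less than half, so
  both parts sum into \<open>W (Suc m)\<close> by induction; \<open>p\<close> alone costs less than
  the bound, so its exponent is at least \<open>Suc m\<close>. The three-summand property returns to
  \<open>W m\<close>.\<close>

lemma chain_sum_in: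
  fixes W :: "nat \<Rightarrow> 'a::comm_monoid_add set"
  assumes W0: "\<And>n. 0 \<in> W n"
    and W3: "\<And>n a b c. \<lbrakk>a \<in> W (Suc n); b \<in> W (Suc n); c \<in> W (Suc n)\<rbrakk> \<Longrightarrow> a + b + c \<in> W n"
  shows "chain W ps \<Longrightarrow> chain_cost ps < (1 / 2) ^ m \<Longrightarrow> chain_sum ps \<in> W m"
proof (induction "length ps" arbitrary: ps m rule: less_induct)
  case less
  have dec: "W n \<subseteq> W k" if "k \<le> n" for k n
    using that
  proof (rule lift_Suc_antimono_le[rotated])
    show "W (Suc n) \<subseteq> W n" for n using W3[OF _ W0 W0] by fastforce
  qed
  show ?case
  proof (cases "ps = []")
    case False
    define h :: real where "h = (1 / 2) ^ Suc m"
    define k where "k = (GREATEST i. i < length ps \<and> chain_cost (take i ps) < h)"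
    have ex: "0 < length ps \<and> chain_cost (take 0 ps) < h"
      using False by (simp add: h_def)
    have k: "k < length ps" "chain_cost (take k ps) < h"
      using GreatestI_nat[of "\<lambda>i. i < length ps \<and> chain_cost (take i ps) < h", OF ex, of "length ps"]
      by (auto simp: k_def)
    have kmax: "i \<le> k" if "i < length ps" "chain_cost (take i ps) < h" for i
      using Greatest_le_nat[of "\<lambda>i. i < length ps \<and> chain_cost (take i ps) < h" i "length ps"] that
      by (auto simp: k_def)
    define p where "p = ps ! k"
    have ps: "ps = take k ps @ p # drop (Suc k) ps"
      using k(1) id_take_nth_drop p_def by blast
    have tk: "take (Suc k) ps = take k ps @ [p]"
      using k(1) by (simp add: p_def take_Suc_conv_app_nth)
    have ch: "chain W (take k ps)" "fst p \<in> W (snd p)" "chain W (drop (Suc k) ps)"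
      using less.prems(1) by (subst (asm) ps, simp)+
    have cost: "chain_cost (take k ps) + ((1 / 2) ^ snd p + chain_cost (drop (Suc k) ps)) < 2 * h"
      using less.prems(2) by (subst (asm) ps) (simp add: h_def)
    have "chain_cost (drop (Suc k) ps) < h"
    proof (cases "Suc k < length ps")
      case True
      then have "\<not> chain_cost (take (Suc k) ps) < h" using kmax[of "Suc k"] by auto
      then show ?thesis using cost unfolding tk by simp
    qed (simp add: h_def)
    then have suf: "chain_sum (drop (Suc k) ps) \<in> W (Suc m)"
      using less.hyps[of "drop (Suc k) ps"] ch k(1) unfolding h_def by simp
    have pre: "chain_sum (take k ps) \<in> W (Suc m)"
      using less.hyps[of "take k ps"] ch k unfolding h_def by simp
    have "(1 / 2 :: real) ^ snd p < (1 / 2) ^ m"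
      using cost chain_cost_nonneg[of "take k ps"] chain_cost_nonneg[of "drop (Suc k) ps"] h_def
      by (simp only: power_Suc)
    then have "Suc m \<le> snd p"
      using power_decreasing[of "snd p" m "1 / 2 :: real"] by (cases "snd p \<le> m") auto
    then have mid: "fst p \<in> W (Suc m)" using dec ch by blast
    show ?thesis
      using W3[OF pre mid suf] by (subst ps) (simp add: add.assoc)
  qed (simp add: W0)
qed

text \<open>The chain norm vanishes at zero, is continuous, and is at least 1/2 off
  \<open>U\<close>, because a cheaper chain would sum into \<open>W (Suc 0)\<close>, a subset of
  \<open>U\<close>. Doubling and truncating it at 1 gives the function.\<close>

lemma topological_group_urysohn:
  fixes U :: "'a::topological_ab_group_add set"
  assumes "open U" "0 \<in> U"
  obtains f :: "'a \<Rightarrow> real" where "continuous_on UNIV f" "f 0 = 0" "\<And>x. x \<notin> U \<Longrightarrow> f x = 1"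
proof -
  \<comment> \<open>The case \<open>n = 0\<close> forces \<open>W (Suc 0)\<close> into
    \<open>U\<close>, while \<open>W 0\<close> stays the whole group so that every element is the
    sum of some chain and the infimum is over a nonempty set.\<close>
  define good where "good n V V' \<longleftrightarrow>
     (\<forall>a\<in>V'. \<forall>b\<in>V'. \<forall>c\<in>V'. a + b + c \<in> V \<inter> (if n = 0 then U else UNIV))"
     for n :: nat and V V' :: "'a set"
  have "\<exists>W. \<forall>n. (open (W n) \<and> 0 \<in> W n \<and> (n = 0 \<longrightarrow> W n = UNIV) \<and> (\<forall>a\<in>W n. - a \<in> W n)) \<and> good n (W n) (W (Suc n))"
  proof (rule dependent_nat_choice)
    show "\<exists>x::'a set. open x \<and> 0 \<in> x \<and> ((0::nat) = 0 \<longrightarrow> x = UNIV) \<and> (\<forall>a\<in>x. - a \<in> x)"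
      by auto
    fix V :: "'a set" and n :: nat
    assume V: "open V \<and> 0 \<in> V \<and> (n = 0 \<longrightarrow> V = UNIV) \<and> (\<forall>a\<in>V. - a \<in> V)"
    define X where "X = V \<inter> (if n = 0 then U else UNIV)"
    have X: "open X" "0 \<in> X"
      using V assms by (auto simp: X_def)
    show "\<exists>y. (open y \<and> 0 \<in> y \<and> (Suc n = 0 \<longrightarrow> y = UNIV) \<and> (\<forall>a\<in>y. - a \<in> y)) \<and> good n V y"
    proof (rule open_zero_third[OF X])
      fix V' :: "'a set"
      assume V': "open V'" "0 \<in> V'" "\<And>a. a \<in> V' \<Longrightarrow> - a \<in> V'"
        and "\<And>a b c. \<lbrakk>a \<in> V'; b \<in> V'; c \<in> V'\<rbrakk> \<Longrightarrow> a + b + c \<in> X"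
      then have "good n V V'"
        unfolding good_def X_def by blast
      with V' show ?thesis
        by (intro exI[of _ V'] conjI ballI impI) simp_all
    qed
  qed
  then obtain W where W: "\<And>n. open (W n)" "\<And>n. 0 \<in> W n" "W 0 = UNIV" "\<And>n a. a \<in> W n \<Longrightarrow> - a \<in> W n"
    and good: "\<And>n. good n (W n) (W (Suc n))"
    by metis
  have W3: "a + b + c \<in> W n" if "a \<in> W (Suc n)" "b \<in> W (Suc n)" "c \<in> W (Suc n)" for a b c n
    using good[of n] that by (auto simp: good_def)
  have WU: "W (Suc 0) \<subseteq> U"
    using good[of 0] W(2)[of "Suc 0"] unfolding good_def by fastforce
  define N where "N = chain_norm W"
  have bdd: "bdd_below (chain_cost ` {ps. chain W ps \<and> chain_sum ps = g})" for g
    using chain_cost_nonneg by (auto intro!: bdd_belowI)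
  have ne: "{ps. chain W ps \<and> chain_sum ps = g} \<noteq> {}" for g
  proof -
    have "chain W [(g, 0)]" "chain_sum [(g, 0::nat)] = g" using W by auto
    then show ?thesis by blast
  qed
  have N_le: "N (chain_sum ps) \<le> chain_cost ps" if "chain W ps" for ps
    unfolding N_def chain_norm_def using that bdd by (intro cInf_lower) auto
  have N_nonneg: "0 \<le> N g" for g
    unfolding N_def chain_norm_def using ne chain_cost_nonneg by (intro cInf_greatest) auto
  have N_ex: "\<exists>ps. chain W ps \<and> chain_sum ps = g \<and> chain_cost ps < t" if "N g < t" for g t
    using cInf_lessD[of "chain_cost ` {ps. chain W ps \<and> chain_sum ps = g}"] that ne
    unfolding N_def chain_norm_def by fastforce
  have N0: "N 0 = 0"
    using N_le[of "[]"] N_nonneg[of 0] by simp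
  have N_add: "N (g + v) \<le> N g + (1 / 2) ^ n" if v: "v \<in> W n" for g v n
  proof (rule field_le_epsilon)
    fix e :: real assume "e > 0"
    then obtain ps where ps: "chain W ps" "chain_sum ps = g" "chain_cost ps < N g + e"
      using N_ex[of g "N g + e"] by auto
    have "N (chain_sum (ps @ [(v, n)])) \<le> chain_cost (ps @ [(v, n)])"
      using ps v by (intro N_le) auto
    then show "N (g + v) \<le> N g + (1 / 2) ^ n + e"
      using ps by simp
  qed
  have cont: "continuous_on UNIV N"
    unfolding continuous_on_def
  proof (intro ballI tendstoI)
    fix x :: 'a and e :: real assume "e > 0"
    then obtain n where n: "(1 / 2) ^ n < e"
      using real_arch_pow_inv[of e "1 / 2"] by auto
    have op: "open ((\<lambda>y. y + - x) -` W n)"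
      by (intro open_vimage W continuous_add_const)
    \<comment> \<open>Symmetry of \<open>W n\<close> lets the difference be added in either
      direction, which bounds the norm change from both sides.\<close>
    have "dist (N y) (N x) < e" if "y + - x \<in> W n" for y
    proof -
      have "N y \<le> N x + (1 / 2) ^ n" using N_add[OF that, of x] by simp
      moreover have "N x \<le> N y + (1 / 2) ^ n" using N_add[OF W(4)[OF that], of y] by simp
      ultimately show ?thesis using n by (simp add: dist_real_def)
    qed
    then have "eventually (\<lambda>y. dist (N y) (N x) < e) (nhds x)"
      unfolding eventually_nhds using op W(2)
      by (intro exI[of _ "(\<lambda>y. y + - x) -` W n"]) auto
    then show "\<forall>\<^sub>F y in at x within UNIV. dist (N y) (N x) < e"
      by (simp add: eventually_at_filter eventually_mono)
  qed
  have big: "N x \<ge> 1 / 2" if "x \<notin> U" for x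
  proof (rule ccontr)
    assume "\<not> ?thesis"
    then obtain ps where "chain W ps" "chain_sum ps = x" "chain_cost ps < 1 / 2"
      using N_ex[of x "1 / 2"] by auto
    then have "x \<in> W (Suc 0)"
      using chain_sum_in[of W ps "Suc 0"] W(2) W3 by auto
    with WU that show False by blast
  qed
  show ?thesis
  proof
    show "continuous_on UNIV (\<lambda>x. min 1 (2 * N x))"
      using cont by (intro continuous_intros) auto
    show "min 1 (2 * N 0) = 0" using N0 by simp
    show "min 1 (2 * N x) = 1" if "x \<notin> U" for x using big[OF that] by simp
  qed
qed

lemma topological_group_urysohn_at:
  fixes U :: "'a::topological_ab_group_add set"
  assumes "open U" "a \<in> U"
  obtains f :: "'a \<Rightarrow> real" where "continuous_on UNIV f" "f a = 0" "\<And>x. x \<notin> U \<Longrightarrow> f x = 1"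
proof -
  have "open ((\<lambda>x. x + a) -` U)" "0 \<in> (\<lambda>x. x + a) -` U"
    using assms by (auto intro!: open_vimage continuous_add_const)
  from topological_group_urysohn[OF this] obtain f :: "'a \<Rightarrow> real"
    where f: "continuous_on UNIV f" "f 0 = 0" "\<And>x. x + a \<notin> U \<Longrightarrow> f x = 1"
    by (metis vimage_eq)
  show ?thesis
  proof
    show "continuous_on UNIV (\<lambda>x. f (x + - a))"
      by (rule continuous_on_compose2[OF f(1) continuous_add_const]) auto
  qed (use f in auto)
qed

text \<open>An injective sequence in \<open>A\<close> accumulates at some \<open>a\<close> but does
  not converge to it, so infinitely many terms avoid a neighbourhood \<open>U\<close> of
  \<open>a\<close> and accumulate at some \<open>b\<close> outside \<open>U\<close>. A function that
  is 0 at \<open>a\<close> and 1 off \<open>U\<close> separates terms near \<open>a\<close> from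
  terms near \<open>b\<close>; the gap between the levels 1/3 and 2/3 keeps the closures
  disjoint.\<close>

lemma infinite_closure_split:
  fixes A :: "'a::{topological_ab_group_add, t2_space} set"
  assumes cc: "countably_compact (UNIV :: 'a set)"
    and ncs: "\<And>s :: nat \<Rightarrow> 'a. \<not> nontrivial_convergent_seq s"
    and A: "infinite A"
  obtains B C where "B \<subseteq> A" "C \<subseteq> A" "infinite B" "infinite C" "closure B \<inter> closure C = {}"
proof -
  have acc: "\<exists>l. \<forall>U. l \<in> U \<and> open U \<longrightarrow> infinite (U \<inter> T)" if T: "infinite T" for T :: "'a set"
  proof -
    obtain T' where "T' \<subseteq> T" "infinite T'" "countable T'"
      using infinite_countable_subset'[OF T] by blast
    with countably_compact_imp_acc_point[OF cc, of T'] obtain l where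
      "\<And>U. l \<in> U \<and> open U \<Longrightarrow> infinite (U \<inter> T')" by auto
    then show ?thesis
      using \<open>T' \<subseteq> T\<close> by (meson Int_mono finite_subset subset_refl)
  qed
  obtain s :: "nat \<Rightarrow> 'a" where s: "inj s" "range s \<subseteq> A"
    using infinite_countable_subset[OF A] by blast
  have infs: "infinite (s ` M)" if "infinite M" for M
    using that s(1) by (meson finite_imageD inj_on_subset subset_UNIV)
  obtain a where a: "\<And>U. a \<in> U \<Longrightarrow> open U \<Longrightarrow> infinite (U \<inter> range s)"
    using acc[OF infs, of UNIV] by auto
  have "\<not> (\<exists>c. \<forall>\<^sub>F n in sequentially. s n = c)"
  proof
    assume "\<exists>c. \<forall>\<^sub>F n in sequentially. s n = c"
    then obtain c k where "\<And>n. n \<ge> k \<Longrightarrow> s n = c"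
      unfolding eventually_sequentially by blast
    from this[of k] this[of "Suc k"] have "s k = s (Suc k)" by simp
    with s(1) show False by (simp add: inj_eq)
  qed
  with ncs[of s] have "\<not> s \<longlonglongrightarrow> a"
    unfolding nontrivial_convergent_seq_def by blast
  then obtain U where U: "open U" "a \<in> U" "\<not> (\<forall>\<^sub>F n in sequentially. s n \<in> U)"
    unfolding tendsto_def by blast
  then have "infinite {n. s n \<notin> U}"
    by (simp add: eventually_cofinite flip: cofinite_eq_sequentially)
  from acc[OF infs[OF this]] obtain b
    where b: "\<And>V. b \<in> V \<Longrightarrow> open V \<Longrightarrow> infinite (V \<inter> s ` {n. s n \<notin> U})" by blast
  have "U \<inter> s ` {n. s n \<notin> U} = {}" by auto
  then have "b \<notin> U" using b[of U] U(1) by fastforce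
  obtain f :: "'a \<Rightarrow> real" where f: "continuous_on UNIV f" "f a = 0" "\<And>x. x \<notin> U \<Longrightarrow> f x = 1"
    using topological_group_urysohn_at[OF U(1,2)] by blast
  have op: "open {x. f x < 1 / 3}" "open {x. f x > 2 / 3}"
    using f(1) by (auto intro!: open_Collect_less continuous_intros)
  have cl: "closed {x. f x \<le> 1 / 3}" "closed {x. f x \<ge> 2 / 3}"
    using f(1) by (auto intro!: closed_Collect_le continuous_intros)
  have "infinite ({x. f x < 1 / 3} \<inter> range s)"
    using op f by (intro a) auto
  moreover have "infinite ({x. f x > 2 / 3} \<inter> range s)"
  proof (rule infinite_super)
    show "infinite ({x. f x > 2 / 3} \<inter> s ` {n. s n \<notin> U})"
      using op f \<open>b \<notin> U\<close> by (intro b) auto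
  qed auto
  moreover have "closure ({x. f x < 1 / 3} \<inter> range s) \<subseteq> {x. f x \<le> 1 / 3}"
    by (rule closure_minimal) (use cl in auto)
  moreover have "closure ({x. f x > 2 / 3} \<inter> range s) \<subseteq> {x. f x \<ge> 2 / 3}"
    by (rule closure_minimal) (use cl in auto)
  ultimately show ?thesis
    using s(2) by (intro that[of "{x. f x < 1 / 3} \<inter> range s" "{x. f x > 2 / 3} \<inter> range s"]) fastforce+
qed

text \<open>Repeated splitting builds a Cantor scheme of infinite subsets. Every branch has a limit
  point of \<open>A\<close> lying in the closures of all its sets, and two branches are separated by
  the disjoint closures at their first difference, so there are at least as many limit points as
  branches.\<close>

lemma continuum_limit_points:
  fixes A :: "'a::{topological_ab_group_add, t2_space} set"
  assumes cc: "countably_compact (UNIV :: 'a set)"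
    and ncs: "\<And>s :: nat \<Rightarrow> 'a. \<not> nontrivial_convergent_seq s"
    and A: "infinite A"
  shows "|UNIV :: (nat \<Rightarrow> nat) set| \<le>o |{l. l islimpt A}|"
proof -
  have "\<exists>Bs. \<forall>A::'a set. infinite A \<longrightarrow> (\<forall>i::bool. Bs A i \<subseteq> A \<and> infinite (Bs A i)) \<and> closure (Bs A True) \<inter> closure (Bs A False) = {}"
  proof (rule choice, rule allI)
    fix A :: "'a set"
    show "\<exists>Bs. infinite A \<longrightarrow> (\<forall>i::bool. Bs i \<subseteq> A \<and> infinite (Bs i)) \<and> closure (Bs True) \<inter> closure (Bs False) = {}"
    proof (cases "finite A")
      case False
      from infinite_closure_split[OF cc ncs False] obtain B C where
        "B \<subseteq> A" "C \<subseteq> A" "infinite B" "infinite C" "closure B \<inter> closure C = {}" by blast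
      then show ?thesis
        by (intro exI[of _ "\<lambda>i. if i then B else C"]) simp
    qed simp
  qed
  then obtain Bs :: "'a set \<Rightarrow> bool \<Rightarrow> 'a set" where Bs: "\<And>A i. infinite A \<Longrightarrow> Bs A i \<subseteq> A" "\<And>A i. infinite A \<Longrightarrow> infinite (Bs A i)"
    "\<And>A. infinite A \<Longrightarrow> closure (Bs A True) \<inter> closure (Bs A False) = {}"
    by blast
  define T where "T f = rec_nat A (\<lambda>n X. Bs X (f n))" for f :: "nat \<Rightarrow> bool"
  have T0: "T f 0 = A" and TS: "T f (Suc n) = Bs (T f n) (f n)" for f n
    by (simp_all add: T_def)
  have Tinf: "infinite (T f n)" for f n
    by (induction n) (simp_all add: T0 TS A Bs)
  have Tdec: "T f n \<subseteq> T f m" if "m \<le> n" for f m n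
    using that by (rule lift_Suc_antimono_le[rotated]) (simp add: TS Bs Tinf)
  have Tcong: "T f n = T g n" if "\<And>k. k < n \<Longrightarrow> f k = g k" for f g n
    using that by (induction n) (simp_all add: T0 TS)
  have "\<exists>l. l islimpt A \<and> (\<forall>n. l \<in> closure (T f n))" for f
  proof -
    \<comment> \<open>Choose pairwise distinct points, one from each set of the branch. From index
      \<open>n\<close> on they lie in \<open>T f n\<close>, so an accumulation point of the sequence
      lies in every closure.\<close>
    have "\<exists>s::nat \<Rightarrow> 'a. \<forall>n. s n \<in> T f n \<and> s n \<notin> s ` {..<n}"
    proof -
      have "\<exists>s::nat \<Rightarrow> 'a. \<forall>n. s n \<in> T f n - s ` {..<n}"
      proof (rule dependent_wellorder_choice)
        fix n and s :: "nat \<Rightarrow> 'a"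
        have "infinite (T f n - s ` {..<n})" using Tinf by simp
        then show "\<exists>r. r \<in> T f n - s ` {..<n}" by (metis ex_in_conv finite.emptyI)
      next
        fix r and s g :: "nat \<Rightarrow> 'a" and n assume "\<And>k. k < n \<Longrightarrow> s k = g k"
        then have "s ` {..<n} = g ` {..<n}" by auto
        then show "(r \<in> T f n - s ` {..<n}) = (r \<in> T f n - g ` {..<n})" by simp
      qed
      then show ?thesis by blast
    qed
    then obtain s :: "nat \<Rightarrow> 'a" where s: "\<And>n. s n \<in> T f n" "\<And>n. s n \<notin> s ` {..<n}" by blast
    have "s m \<noteq> s n" if "m < n" for m n
      using s(2)[of n] that by (metis imageI lessThan_iff)
    then have inj: "inj s" by (metis injI linorder_neqE_nat)
    then have "infinite (range s)" by (rule range_inj_infinite)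
    with countably_compact_imp_acc_point[OF cc, of "range s"] obtain l where
      l: "\<And>U. l \<in> U \<Longrightarrow> open U \<Longrightarrow> infinite (U \<inter> range s)" by auto
    have "l islimpt A"
      unfolding islimpt_def
    proof (intro allI impI)
      fix U assume "l \<in> U" "open U"
      then have "infinite (U \<inter> range s - {l})" using l by simp
      then obtain y where "y \<in> U \<inter> range s - {l}" by (metis ex_in_conv finite.emptyI)
      moreover have "range s \<subseteq> A" using s(1) Tdec[OF le0] T0 by (metis image_subset_iff subsetD)
      ultimately show "\<exists>y\<in>A. y \<in> U \<and> y \<noteq> l" by blast
    qed
    moreover have "l \<in> closure (T f n)" for n
      unfolding closure_iff_nhds_not_empty
    proof (intro allI impI)
      fix V U assume U: "U \<subseteq> V" "l \<in> U" "open U"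
      then have "infinite (U \<inter> range s - s ` {..<n})" using l by simp
      then obtain y where y: "y \<in> U \<inter> range s - s ` {..<n}" by (metis ex_in_conv finite.emptyI)
      then obtain k where "y = s k" "k \<ge> n" by fastforce
      then have "y \<in> T f n" using s(1)[of k] Tdec by blast
      then show "T f n \<inter> V \<noteq> {}" using y U by blast
    qed
    ultimately show ?thesis by blast
  qed
  then obtain l where l: "\<And>f. l f islimpt A" "\<And>f n. l f \<in> closure (T f n)" by metis
  have "inj l"
  proof (rule injI, rule ccontr)
    fix f g assume eq: "l f = l g" and "f \<noteq> g"
    then obtain k where "f k \<noteq> g k" by blast
    define n where "n = (LEAST k. f k \<noteq> g k)"
    have n: "f n \<noteq> g n" using \<open>f k \<noteq> g k\<close> LeastI[of "\<lambda>k. f k \<noteq> g k"] n_def by auto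
    have "T f n = T g n"
      by (rule Tcong) (use not_less_Least n_def in blast)
    then have "l f \<in> closure (Bs (T f n) (f n)) \<inter> closure (Bs (T f n) (g n))"
      using l(2)[of f "Suc n"] l(2)[of g "Suc n"] eq by (simp add: TS)
    then show False
      using n Bs(3)[OF Tinf, of f n] by (cases "f n"; cases "g n") auto
  qed
  then have "|UNIV :: (nat \<Rightarrow> bool) set| \<le>o |{l. l islimpt A}|"
    by (rule card_of_ordLeqI) (use l in auto)
  moreover have "|UNIV :: (nat \<Rightarrow> nat) set| \<le>o |UNIV :: (nat \<Rightarrow> bool) set|"
  proof (rule card_of_ordLeqI)
    \<comment> \<open>A function is recovered from the characteristic function of its graph.\<close>
    show "inj (\<lambda>(f :: nat \<Rightarrow> nat) k. case prod_decode k of (i, j) \<Rightarrow> f i = j)"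
    proof (intro injI ext)
      fix f g :: "nat \<Rightarrow> nat" and i
      assume "(\<lambda>k. case prod_decode k of (i, j) \<Rightarrow> f i = j) = (\<lambda>k. case prod_decode k of (i, j) \<Rightarrow> g i = j)"
      from fun_cong[OF this, of "prod_encode (i, g i)"] show "f i = g i" by simp
    qed
  qed auto
  ultimately show ?thesis by (rule ordLeq_transitive[rotated])
qed

section \<open>The independent family\<close>

type_synonym idx = "nat \<Rightarrow> nat"

text \<open>The cardinal order serves as the well-order of the recursion: its type is initial, so
  each \<open>underS idx_ord \<alpha>\<close> has fewer than continuum many elements.\<close>

abbreviation idx_ord :: "idx rel" where
  "idx_ord \<equiv> |UNIV :: idx set|"

lemma idx_wo_rel: "wo_rel idx_ord"
  by (simp add: wo_rel_def card_of_Well_order)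

lemma wf_idx_ord: "wf (idx_ord - Id)"
  using card_of_Well_order[of "UNIV :: idx set"] by (simp add: well_order_on_def)

lemma infinite_idx: "infinite (UNIV :: idx set)"
  using finite_fun_UNIVD2 by force

lemma nat_less_idx: "|UNIV :: nat set| <o idx_ord"
proof -
  have "\<not> idx_ord \<le>o |UNIV :: nat set|"
  proof
    assume "idx_ord \<le>o |UNIV :: nat set|"
    then obtain g :: "idx \<Rightarrow> nat" where g: "inj g"
      unfolding card_of_ordLeq[symmetric] by blast
    define d where "d n = Suc (inv g n n)" for n
    have "inv g (g d) = d" using g by simp
    then have "d (g d) = Suc (d (g d))" by (metis d_def)
    then show False by simp
  qed
  then show ?thesis
    by (simp add: card_of_Well_order not_ordLeq_iff_ordLess)
qed

text \<open>A formal element: the integer multiple \<^term>\<open>i - j\<close> of the base point plus a sum of generators.\<close>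
type_synonym code = "(nat \<times> nat) \<times> idx list"

definition code_val :: "'a::ab_group_add \<Rightarrow> (idx \<Rightarrow> 'a) \<Rightarrow> code \<Rightarrow> 'a" where
  "code_val x r c = (case c of ((i, j), L) \<Rightarrow> nmul i x - nmul j x + sum_list (map r L))"

lemma code_val_simp [simp]:
  "code_val x r ((i, j), L) = nmul i x - nmul j x + sum_list (map r L)"
  by (simp add: code_val_def)

lemma code_val_add:
  "code_val x r ((i, j), L) + code_val x r ((k, l), M) = code_val x r ((i + k, j + l), L @ M)"
  by (simp add: nmul_add algebra_simps)

text \<open>A single index encodes a sequence of codes together with a free parameter; entry
  \<open>(n, m)\<close> stores the integer pair of the \<open>n\<close>-th code and the
  \<open>m\<close>-th values of its indices and of the parameter. The parameter gives each sequence
  continuum many indices, so one of them can be found above all indices occurring in the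
  sequence.\<close>

definition seq_idx :: "(nat \<Rightarrow> code) \<times> idx \<Rightarrow> idx" where
  "seq_idx p k = (case prod_decode k of (n, m) \<Rightarrow>
     to_nat (fst (fst p n), map (\<lambda>f. f m) (snd (fst p n)), snd p m))"

lemma inj_seq_idx: "inj seq_idx"
proof (rule injI)
  fix p q :: "(nat \<Rightarrow> code) \<times> idx"
  assume eq: "seq_idx p = seq_idx q"
  have *: "fst (fst p n) = fst (fst q n) \<and> map (\<lambda>f. f m) (snd (fst p n)) = map (\<lambda>f. f m) (snd (fst q n)) \<and>
        snd p m = snd q m" for n m
    using fun_cong[OF eq, of "prod_encode (n, m)"] by (simp add: seq_idx_def)
  have "snd (fst p n) = snd (fst q n)" for n
  proof (rule nth_equalityI)
    show len: "length (snd (fst p n)) = length (snd (fst q n))"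
      using * by (metis length_map)
    fix i assume i: "i < length (snd (fst p n))"
    show "snd (fst p n) ! i = snd (fst q n) ! i"
    proof
      fix m
      have "map (\<lambda>f. f m) (snd (fst p n)) ! i = map (\<lambda>f. f m) (snd (fst q n)) ! i"
        using *[of n m] by simp
      then show "(snd (fst p n) ! i) m = (snd (fst q n) ! i) m"
        using i len by simp
    qed
  qed
  with * show "p = q"
    by (auto intro!: prod_eqI ext)
qed

lemma pure_hull_sum_list:
  "x \<in> B \<Longrightarrow> set ys \<subseteq> pure_hull B \<Longrightarrow> sum_list ys \<in> pure_hull B"
  by (induction ys) (auto intro: pure_hull_0 pure_hull_add)

lemma sum_list_map_partition:
  "sum_list (map r L) =
     nmul (length (filter ((=) a) L)) (r a) + sum_list (map (r :: _ \<Rightarrow> 'a::comm_monoid_add) (filter ((\<noteq>) a) L))"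
  by (induction L) (auto simp: nmul_Suc ac_simps)

text \<open>Let \<open>a\<close> be the largest index in \<open>L\<close>. Equality would put a
  positive multiple of \<open>r a\<close> into the pure hull of \<open>x\<close> and the earlier
  generators, and by purity \<open>r a\<close> itself, against the assumption.\<close>

lemma code_val_not_multiple:
  fixes x :: "'a::ab_group_add"
  assumes r: "\<And>\<alpha>. r \<alpha> \<notin> pure_hull (insert x (r ` underS idx_ord \<alpha>))"
    and L: "L \<noteq> []"
  shows "code_val x r ((i, j), L) \<noteq> nmul k x - nmul l x"
proof
  assume eq: "code_val x r ((i, j), L) = nmul k x - nmul l x"
  obtain a where a: "a \<in> set L" "\<And>b. b \<in> set L \<Longrightarrow> b \<noteq> a \<Longrightarrow> b \<in> underS idx_ord a"
  proof -
    have "\<exists>a\<in>M. \<forall>b\<in>M. b \<noteq> a \<longrightarrow> b \<in> underS idx_ord a" if "finite M" "M \<noteq> {}" for M :: "idx set"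
      using that
    proof (induction rule: finite_ne_induct)
      case (insert b M)
      then obtain a where a: "a \<in> M" "\<forall>b\<in>M. b \<noteq> a \<longrightarrow> b \<in> underS idx_ord a" by blast
      have tot: "b \<in> underS idx_ord a \<or> a \<in> underS idx_ord b"
        using insert a wo_rel.TOTALS[OF idx_wo_rel] by (auto simp: underS_def Field_card_of)
      have tr: "c \<in> underS idx_ord b" if "a \<in> underS idx_ord b" "c \<in> underS idx_ord a" for c
        using that transD[OF wo_rel.TRANS[OF idx_wo_rel], of c a b]
          antisymD[OF wo_rel.ANTISYM[OF idx_wo_rel], of c a] by (auto simp: underS_def)
      show ?case
        using tot
      proof
        assume "a \<in> underS idx_ord b"
        with a tr show ?thesis by (intro bexI[of _ b]) auto
      next
        assume "b \<in> underS idx_ord a"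
        with a show ?thesis by (intro bexI[of _ a]) auto
      qed
    qed auto
    with L that show ?thesis by (metis List.finite_set set_empty)
  qed
  define B where "B = insert x (r ` underS idx_ord a)"
  define n where "n = length (filter ((=) a) L)"
  have n: "n > 0" using a(1) by (auto simp: n_def filter_empty_conv)
  have x: "x \<in> B" by (simp add: B_def)
  have "set (map r (filter ((\<noteq>) a) L)) \<subseteq> pure_hull B"
    using a(2) by (auto simp: B_def intro!: pure_hull.base)
  then have "sum_list (map r (filter ((\<noteq>) a) L)) \<in> pure_hull B"
    by (rule pure_hull_sum_list[OF x])
  moreover have "nmul n (r a) =
      (nmul k x - nmul l x) - (nmul i x - nmul j x) - sum_list (map r (filter ((\<noteq>) a) L))"
    using eq by (simp add: sum_list_map_partition[of r L a] n_def algebra_simps)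
  ultimately have "nmul n (r a) \<in> pure_hull B"
    using pure_hull_nmul[OF pure_hull.base[OF x]] by (simp add: pure_hull.diff)
  then show False
    using pure_hull.root[OF _ n] r[of a] B_def by blast
qed

text \<open>\<open>R\<close> consists of the values of all codes with at least one generator.
  Independence keeps it away from the multiples of \<open>x\<close>, and each relevant sequence
  received a limit point among the generators during the recursion.\<close>

lemma countably_compact_ideal:
  fixes x :: "'a::{topological_ab_group_add, t2_space}"
  assumes tf: "torsion_free TYPE('a)" and x: "x \<noteq> 0"
    and cc: "countably_compact (UNIV :: 'a set)"
    and ncs: "\<And>s :: nat \<Rightarrow> 'a. \<not> nontrivial_convergent_seq s"
  obtains R :: "'a set" where
    "\<And>a b. \<lbrakk>a \<in> R; b \<in> R\<rbrakk> \<Longrightarrow> a + b \<in> R"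
    "\<And>a i j. a \<in> R \<Longrightarrow> a + (nmul i x - nmul j x) \<in> R"
    "\<And>i j. nmul i x - nmul j x \<notin> R"
    "\<And>A. \<lbrakk>infinite A; A \<subseteq> R \<union> range (\<lambda>(i, j). nmul i x - nmul j x)\<rbrakk> \<Longrightarrow> \<exists>l\<in>R. l islimpt A"
proof -
  \<comment> \<open>The demand on the generator \<open>y\<close> at stage \<alpha>: it is
    independent of \<open>x\<close> and the earlier generators, and it is a limit point of the
    sequence decoded from \<alpha>, whenever that sequence has infinite range and mentions earlier
    generators only.\<close>
  define P :: "(idx \<Rightarrow> 'a) \<Rightarrow> idx \<Rightarrow> 'a \<Rightarrow> bool" where
    "P f \<alpha> y \<longleftrightarrow> y \<notin> pure_hull (insert x (f ` underS idx_ord \<alpha>)) \<and>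
       (let t = fst (inv seq_idx \<alpha>) in
         infinite (range (\<lambda>n. code_val x f (t n))) \<and> (\<forall>n. set (snd (t n)) \<subseteq> underS idx_ord \<alpha>) \<longrightarrow>
         y islimpt range (\<lambda>n. code_val x f (t n)))" for f \<alpha> y
  have "\<exists>r. \<forall>\<alpha>. P r \<alpha> (r \<alpha>)"
  proof (rule dependent_wf_choice[OF wf_idx_ord])
    fix f g :: "idx \<Rightarrow> 'a" and \<alpha> y
    assume fg: "\<And>z. (z, \<alpha>) \<in> idx_ord - Id \<Longrightarrow> f z = g z"
    then have eq: "f z = g z" if "z \<in> underS idx_ord \<alpha>" for z
      using that by (auto simp: underS_def)
    have 1: "f ` underS idx_ord \<alpha> = g ` underS idx_ord \<alpha>"
      using eq by auto
    have 2: "(\<lambda>n. code_val x f (t n)) = (\<lambda>n. code_val x g (t n))"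
      if "\<forall>n. set (snd (t n)) \<subseteq> underS idx_ord \<alpha>" for t
    proof
      fix n
      have "map f (snd (t n)) = map g (snd (t n))" using that eq by (auto simp: subset_iff)
      then show "code_val x f (t n) = code_val x g (t n)" by (simp only: code_val_def split_beta)
    qed
    show "P f \<alpha> y = P g \<alpha> y"
      using 2[of "fst (inv seq_idx \<alpha>)"] unfolding P_def Let_def 1 by metis
  next
    fix \<alpha> and f :: "idx \<Rightarrow> 'a"
    let ?t = "fst (inv seq_idx \<alpha>)"
    \<comment> \<open>If the decoded sequence has finite range, only independence is required. The
      multiples of \<open>x\<close> then stand in as an infinite set, so the same count of limit
      points applies.\<close>
    define A where "A = (if infinite (range (\<lambda>n. code_val x f (?t n))) then range (\<lambda>n. code_val x f (?t n))
       else range (\<lambda>n. nmul n x))"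
    have "infinite A"
      using range_inj_infinite[OF torsion_free_inj_nmul[OF tf x]] by (simp add: A_def)
    from continuum_limit_points[OF cc ncs this] have lim: "idx_ord \<le>o |{l. l islimpt A}|" .
    \<comment> \<open>The summand of natural numbers keeps the bound infinite even for a finite
      initial segment, and supplies preimages for \<open>x\<close>.\<close>
    define K where "K = underS idx_ord \<alpha> <+> (UNIV :: nat set)"
    have K: "infinite K" "|K| <o idx_ord"
    proof -
      show "infinite K" by (simp add: K_def finite_Plus_iff)
      have "|underS idx_ord \<alpha>| <o idx_ord"
        by (rule card_of_underS) (simp_all add: Field_card_of card_of_card_order_on)
      then show "|K| <o idx_ord"
        unfolding K_def by (intro card_of_Plus_ordLess_infinite infinite_idx nat_less_idx)
    qed
    have "insert x (f ` underS idx_ord \<alpha>) = case_sum f (\<lambda>_. x) ` K"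
      by (simp add: K_def Plus_def image_Un image_image)
    then have "|pure_hull (insert x (f ` underS idx_ord \<alpha>))| \<le>o |K|"
      by (intro pure_hull_card_le[OF tf K(1)]) (metis card_of_image)
    then have "idx_ord \<le>o |K|" if "{l. l islimpt A} \<subseteq> pure_hull (insert x (f ` underS idx_ord \<alpha>))"
      using ordLeq_transitive[OF lim] ordLeq_transitive[OF card_of_mono1[OF that]] by blast
    then have "\<not> {l. l islimpt A} \<subseteq> pure_hull (insert x (f ` underS idx_ord \<alpha>))"
      using K(2) not_ordLess_ordLeq by blast
    then obtain y where "y islimpt A" "y \<notin> pure_hull (insert x (f ` underS idx_ord \<alpha>))" by blast
    then show "\<exists>y. P f \<alpha> y"
      unfolding P_def Let_def A_def by (intro exI[of _ y]) auto
  qed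
  then obtain r where r: "\<And>\<alpha>. P r \<alpha> (r \<alpha>)" by blast
  then have indep: "r \<alpha> \<notin> pure_hull (insert x (r ` underS idx_ord \<alpha>))" for \<alpha>
    unfolding P_def by blast
  define R where "R = {code_val x r c | c. snd c \<noteq> []}"
  have RI: "code_val x r ((i, j), L) \<in> R" if "L \<noteq> []" for i j L
    unfolding R_def using that by force
  have RE: "\<exists>i j L. a = code_val x r ((i, j), L) \<and> L \<noteq> []" if "a \<in> R" for a
    using that unfolding R_def by force
  have R_add: "a + b \<in> R" if a: "a \<in> R" and b: "b \<in> R" for a b
  proof -
    obtain i j L i' j' L' where "a = code_val x r ((i, j), L)" "L \<noteq> []" "b = code_val x r ((i', j'), L')"
      using RE[OF a] RE[OF b] by blast
    then show ?thesis
      by (simp add: code_val_add RI del: code_val_simp)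
  qed
  have R_shift: "a + (nmul i x - nmul j x) \<in> R" if a: "a \<in> R" for a i j
  proof -
    obtain i' j' L where "a = code_val x r ((i', j'), L)" "L \<noteq> []"
      using RE[OF a] by blast
    moreover have "nmul i x - nmul j x = code_val x r ((i, j), [])"
      by simp
    ultimately show ?thesis
      by (simp only: code_val_add append_Nil2 RI not_False_eq_True)
  qed
  have R_disj: "nmul i x - nmul j x \<notin> R" for i j
    using RE code_val_not_multiple[where x = x and r = r, OF indep] by metis
  have R_acc: "\<exists>l\<in>R. l islimpt A"
    if A: "infinite A" "A \<subseteq> R \<union> range (\<lambda>(i, j). nmul i x - nmul j x)" for A
  proof -
    have "\<exists>c. a = code_val x r c" if "a \<in> A" for a
    proof -
      have "a \<in> R \<union> range (\<lambda>(i, j). nmul i x - nmul j x)"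
        using A(2) that by blast
      then consider "a \<in> R" | i j where "a = nmul i x - nmul j x"
        by auto
      then show ?thesis
      proof cases
        case (2 i j)
        then have "a = code_val x r ((i, j), [])" by simp
        then show ?thesis ..
      qed (auto simp: R_def)
    qed
    then obtain code where code: "\<And>a. a \<in> A \<Longrightarrow> a = code_val x r (code a)" by metis
    obtain s :: "nat \<Rightarrow> 'a" where s: "inj s" "range s \<subseteq> A"
      using infinite_countable_subset[OF A(1)] by blast
    define t where "t n = code (s n)" for n
    have t: "code_val x r (t n) = s n" for n
    proof -
      have "s n \<in> A" using s(2) by blast
      then show ?thesis
        unfolding t_def by (rule code[symmetric])
    qed
    \<comment> \<open>Only countably many generators occur in the sequence, so the parameter \<beta>
      can be chosen to place the index of the sequence above all of them; the generator at that
      index is the desired limit point.\<close>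
    have "countable (\<Union>n. set (snd (t n)))"
      by (intro countable_UN) (auto intro: countable_finite)
    moreover have "inj (\<lambda>\<beta>. seq_idx (t, \<beta>))"
      using inj_seq_idx by (auto intro!: injI dest: injD)
    ultimately obtain \<beta> where \<beta>: "(\<Union>n. set (snd (t n))) \<subseteq> underS idx_ord (seq_idx (t, \<beta>))"
      using countable_bounded_by_inj by blast
    define \<alpha> where "\<alpha> = seq_idx (t, \<beta>)"
    have "fst (inv seq_idx \<alpha>) = t"
      using inj_seq_idx by (simp add: \<alpha>_def)
    then have "r \<alpha> islimpt range s"
      using r[of \<alpha>] \<beta> range_inj_infinite[OF s(1)] unfolding P_def Let_def
      by (simp add: t UN_subset_iff flip: \<alpha>_def)
    then have "r \<alpha> islimpt A"
      using s(2) islimpt_subset by blast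
    moreover have "r \<alpha> \<in> R"
      using RI[of "[\<alpha>]" 0 0] by simp
    ultimately show ?thesis by blast
  qed
  show ?thesis
    using that[OF R_add R_shift R_disj R_acc] .
qed

section \<open>The semigroup extension\<close>

lemma clopen_separating_function:
  assumes "openin X B" "openin X (topspace X - B)"
  shows "continuous_map X euclideanreal (\<lambda>q. if q \<in> B then 0 else 1)"
  unfolding continuous_map_def
proof (intro conjI allI impI)
  fix V :: "real set"
  have B: "B \<subseteq> topspace X" using assms(1) openin_subset by blast
  have "{q \<in> topspace X. (if q \<in> B then 0 else 1) \<in> V} =
      (if 0 \<in> V then B else {}) \<union> (if 1 \<in> V then topspace X - B else {})"
    using B by auto
  then show "openin X {q \<in> topspace X. (if q \<in> B then 0 else 1) \<in> V}"
    using assms by auto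
qed auto

text \<open>If \<open>u 0, u 1, ...\<close> had no finite subcover, choose \<open>s n\<close>
  outside \<open>u 0, ..., u n\<close>. A cluster point lies in some \<open>u k\<close>, which
  contains \<open>s n\<close> only for \<open>n < k\<close>.\<close>

lemma countably_compact_space_if_cluster:
  assumes "\<And>s :: nat \<Rightarrow> 'a. range s \<subseteq> topspace X \<Longrightarrow>
      \<exists>p\<in>topspace X. \<forall>W. openin X W \<and> p \<in> W \<longrightarrow> infinite {n. s n \<in> W}"
  shows "countably_compact_space X"
  unfolding countably_compact_space_def
proof (intro allI impI)
  fix \<U> assume \<U>: "countable \<U> \<and> (\<forall>u\<in>\<U>. openin X u) \<and> topspace X \<subseteq> \<Union>\<U>"
  show "\<exists>F\<subseteq>\<U>. finite F \<and> topspace X \<subseteq> \<Union>F"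
  proof (cases "\<U> = {}")
    case False
    then obtain u :: "nat \<Rightarrow> 'a set" where u: "range u = \<U>"
      using \<U> by (metis range_from_nat_into)
    show ?thesis
    proof (rule ccontr)
      assume no: "\<not> ?thesis"
      have "\<exists>q. q \<in> topspace X \<and> q \<notin> \<Union>(u ` {..n})" for n
      proof -
        have "u ` {..n} \<subseteq> \<U>" "finite (u ` {..n})" using u by auto
        with no have "\<not> topspace X \<subseteq> \<Union>(u ` {..n})" by blast
        then show ?thesis by blast
      qed
      then obtain s where s: "\<And>n. s n \<in> topspace X" "\<And>n. s n \<notin> \<Union>(u ` {..n})" by metis
      then obtain p where p: "p \<in> topspace X" "\<And>W. openin X W \<Longrightarrow> p \<in> W \<Longrightarrow> infinite {n. s n \<in> W}"
        using assms[of s] by blast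
      obtain k where k: "p \<in> u k"
        using \<U> p(1) u by blast
      have "openin X (u k)" using \<U> u by blast
      then have "infinite {n. s n \<in> u k}" using p k by blast
      moreover have "{n. s n \<in> u k} \<subseteq> {..<k}"
      proof
        fix n assume "n \<in> {n. s n \<in> u k}"
        then show "n \<in> {..<k}" using s(2)[of n] by (cases "k \<le> n") auto
      qed
      ultimately show False using finite_subset by blast
    qed
  qed (use \<U> in auto)
qed

lemma bicyclic_mult_simp [simp]:
  "bicyclic_mult (a, b) (c, d) = (a + c - min b c, b + d - min b c)"
  by (simp add: bicyclic_mult_def)

lemma bicyclic_mult_assoc:
  "bicyclic_mult (bicyclic_mult u v) w = bicyclic_mult u (bicyclic_mult v w)"
  by (cases u; cases v; cases w) (auto simp: min_def split: if_splits)

locale bicyclic_extension =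
  fixes x :: "'a::{topological_ab_group_add, t2_space}" and R :: "'a set"
  assumes inj_x: "inj (\<lambda>n. nmul n x)"
    and R_add: "\<And>a b. \<lbrakk>a \<in> R; b \<in> R\<rbrakk> \<Longrightarrow> a + b \<in> R"
    and R_shift: "\<And>a i j. a \<in> R \<Longrightarrow> a + (nmul i x - nmul j x) \<in> R"
    and R_disj: "\<And>i j. nmul i x - nmul j x \<notin> R"
    and R_acc: "\<And>A. \<lbrakk>infinite A; A \<subseteq> R \<union> range (\<lambda>(i, j). nmul i x - nmul j x)\<rbrakk> \<Longrightarrow> \<exists>l\<in>R. l islimpt A"
begin

definition deg :: "nat \<times> nat \<Rightarrow> 'a" where
  "deg z = nmul (fst z) x - nmul (snd z) x"

text \<open>Each nonempty fibre of \<open>deg\<close> is a sequence \<open>(i + k, j + k)\<close>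
  starting with a zero coordinate, and the height is the position \<open>k\<close> in it.\<close>

definition height :: "nat \<times> nat \<Rightarrow> nat" where
  "height z = min (fst z) (snd z)"

definition Z :: "'a set" where
  "Z = range deg"

definition ecarrier :: "('a + nat \<times> nat) set" where
  "ecarrier = Inl ` (R \<union> Z) \<union> range Inr"

definition proj :: "'a + nat \<times> nat \<Rightarrow> 'a" where
  "proj p = case_sum id deg p"

text \<open>As soon as one factor is a group element, the other is projected and the sum is taken in
  the group. The group part is thus an ideal and \<open>proj\<close> a homomorphism.\<close>

fun emult :: "'a + nat \<times> nat \<Rightarrow> 'a + nat \<times> nat \<Rightarrow> 'a + nat \<times> nat" where
  "emult (Inr z) (Inr w) = Inr (bicyclic_mult z w)"
| "emult (Inl g) q = Inl (g + proj q)"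
| "emult p (Inl h) = Inl (proj p + h)"

definition tail :: "'a \<Rightarrow> nat \<Rightarrow> ('a + nat \<times> nat) set" where
  "tail g N = Inr ` {z. deg z = g \<and> N \<le> height z}"

text \<open>The copy of the bicyclic semigroup is discrete, the points over \<^term>\<open>Z\<close> are limits of their
  fibres in it only, and the points over \<^term>\<open>R\<close> carry the topology pulled back along \<^term>\<open>proj\<close>.\<close>
definition eopen :: "('a + nat \<times> nat) set \<Rightarrow> bool" where
  "eopen W \<longleftrightarrow> W \<subseteq> ecarrier \<and>
     (\<forall>r\<in>R. Inl r \<in> W \<longrightarrow> (\<exists>U. open U \<and> r \<in> U \<and> ecarrier \<inter> proj -` U \<subseteq> W)) \<and>
     (\<forall>g\<in>Z. Inl g \<in> W \<longrightarrow> (\<exists>N. tail g N \<subseteq> W))"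

definition etop :: "('a + nat \<times> nat) topology" where
  "etop = topology eopen"

lemma proj_simps [simp]: "proj (Inl g) = g" "proj (Inr z) = deg z"
  by (simp_all add: proj_def)

lemma deg_in_Z [simp]: "deg z \<in> Z"
  by (simp add: Z_def)

lemma Z_not_R: "g \<in> Z \<Longrightarrow> g \<notin> R"
  using R_disj by (auto simp: Z_def deg_def)

lemma R_add_Z: "a \<in> R \<Longrightarrow> g \<in> Z \<Longrightarrow> a + g \<in> R"
  using R_shift by (auto simp: Z_def deg_def)

text \<open>Both coordinates lose the same amount \<open>min b c\<close>, which cancels in the
  difference.\<close>

lemma deg_bicyclic_mult: "deg (bicyclic_mult z w) = deg z + deg w"
proof -
  obtain a b c d where zw: "z = (a, b)" "w = (c, d)" by fastforce
  define m where "m = min b c"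
  have 1: "nmul (a + c - m) x + nmul m x = nmul a x + nmul c x"
    using nmul_add[of "a + c - m" m x] nmul_add[of a c x] by (simp add: m_def)
  have 2: "nmul (b + d - m) x + nmul m x = nmul b x + nmul d x"
    using nmul_add[of "b + d - m" m x] nmul_add[of b d x] by (simp add: m_def)
  have "deg (bicyclic_mult z w) =
      (nmul (a + c - m) x + nmul m x) - (nmul (b + d - m) x + nmul m x)"
    by (simp add: zw deg_def m_def)
  also have "\<dots> = deg z + deg w"
    unfolding 1 2 by (simp add: zw deg_def)
  finally show ?thesis .
qed

lemma Z_add: "g \<in> Z \<Longrightarrow> h \<in> Z \<Longrightarrow> g + h \<in> Z"
  by (auto simp: Z_def simp flip: deg_bicyclic_mult)

lemma deg_eq_iff: "deg (i, j) = deg (k, l) \<longleftrightarrow> i + l = k + j"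
proof -
  have "deg (i, j) = deg (k, l) \<longleftrightarrow> nmul (i + l) x = nmul (k + j) x"
    by (simp add: deg_def nmul_add algebra_simps)
  also have "\<dots> \<longleftrightarrow> i + l = k + j"
    using inj_x by (auto dest: injD)
  finally show ?thesis .
qed

text \<open>The difference of the coordinates is fixed on a fibre, so bounding the smaller one
  bounds both.\<close>

lemma finite_low_fibre: "finite {z. deg z = g \<and> height z < N}"
proof (cases "g \<in> Z")
  case True
  then obtain k l where g: "g = deg (k, l)" by (auto simp: Z_def)
  have "{z. deg z = g \<and> height z < N} \<subseteq> {..N + k} \<times> {..N + l}"
    by (auto simp: g deg_eq_iff height_def)
  then show ?thesis by (rule finite_subset) simp
next
  case False
  then have "{z. deg z = g \<and> height z < N} = {}" using deg_in_Z by blast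
  then show ?thesis by (simp only: finite.emptyI)
qed

lemma proj_emult [simp]: "proj (emult p q) = proj p + proj q"
  by (cases p; cases q) (simp_all add: deg_bicyclic_mult)

lemma emult_eq_Inl: "p \<in> range Inl \<or> q \<in> range Inl \<Longrightarrow> emult p q = Inl (proj p + proj q)"
  by (cases p; cases q) auto

lemma proj_ecarrier: "p \<in> ecarrier \<Longrightarrow> proj p \<in> R \<union> Z"
  by (auto simp: ecarrier_def)

lemma emult_ecarrier:
  assumes "p \<in> ecarrier" "q \<in> ecarrier"
  shows "emult p q \<in> ecarrier"
proof -
  have "proj p + proj q \<in> R \<union> Z"
    using proj_ecarrier[OF assms(1)] proj_ecarrier[OF assms(2)] R_add R_add_Z Z_add
    by (metis Un_iff add.commute)
  then show ?thesis
    by (cases p; cases q) (auto simp: ecarrier_def)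
qed

lemma emult_assoc: "emult (emult p q) s = emult p (emult q s)"
  by (cases p; cases q; cases s) (simp_all add: bicyclic_mult_assoc deg_bicyclic_mult add.assoc)

section \<open>The topology of the extension\<close>

lemma tail_antimono: "M \<le> N \<Longrightarrow> tail g N \<subseteq> tail g M"
  by (auto simp: tail_def)

lemma tail_ecarrier: "tail g N \<subseteq> ecarrier"
  by (auto simp: tail_def ecarrier_def)

lemma eopen_at_R:
  "\<lbrakk>eopen W; r \<in> R; Inl r \<in> W\<rbrakk> \<Longrightarrow> \<exists>U. open U \<and> r \<in> U \<and> ecarrier \<inter> proj -` U \<subseteq> W"
  by (simp add: eopen_def)

lemma eopen_at_Z: "\<lbrakk>eopen W; g \<in> Z; Inl g \<in> W\<rbrakk> \<Longrightarrow> \<exists>N. tail g N \<subseteq> W"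
  by (simp add: eopen_def)

lemma istopology_eopen: "istopology eopen"
  unfolding istopology_def
proof (intro conjI allI impI)
  fix V W assume V: "eopen V" and W: "eopen W"
  show "eopen (V \<inter> W)"
    unfolding eopen_def
  proof (intro conjI ballI impI)
    show "V \<inter> W \<subseteq> ecarrier" using V by (auto simp: eopen_def)
    fix r assume r: "r \<in> R" "Inl r \<in> V \<inter> W"
    then have "Inl r \<in> V" "Inl r \<in> W" by auto
    from eopen_at_R[OF V r(1) this(1)] eopen_at_R[OF W r(1) this(2)]
    obtain A B where "open A" "r \<in> A" "ecarrier \<inter> proj -` A \<subseteq> V"
      "open B" "r \<in> B" "ecarrier \<inter> proj -` B \<subseteq> W"
      by (elim exE conjE)
    then show "\<exists>U. open U \<and> r \<in> U \<and> ecarrier \<inter> proj -` U \<subseteq> V \<inter> W"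
      by (intro exI[of _ "A \<inter> B"]) auto
  next
    fix g assume g: "g \<in> Z" "Inl g \<in> V \<inter> W"
    then have "Inl g \<in> V" "Inl g \<in> W" by auto
    from eopen_at_Z[OF V g(1) this(1)] eopen_at_Z[OF W g(1) this(2)]
    obtain M N where "tail g M \<subseteq> V" "tail g N \<subseteq> W"
      by (elim exE)
    then have "tail g (max M N) \<subseteq> V \<inter> W"
      using tail_antimono[of M "max M N" g] tail_antimono[of N "max M N" g] by auto
    then show "\<exists>N. tail g N \<subseteq> V \<inter> W" ..
  qed
next
  fix \<K> assume K: "\<forall>K\<in>\<K>. eopen K"
  show "eopen (\<Union>\<K>)"
    unfolding eopen_def
  proof (intro conjI ballI impI)
    show "\<Union>\<K> \<subseteq> ecarrier" using K by (auto simp: eopen_def)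
    fix r assume r: "r \<in> R" "Inl r \<in> \<Union>\<K>"
    then obtain K where K': "K \<in> \<K>" "Inl r \<in> K" by blast
    then have "eopen K" using K by blast
    from eopen_at_R[OF this r(1) K'(2)] obtain U where "open U" "r \<in> U" "ecarrier \<inter> proj -` U \<subseteq> K"
      by blast
    with K' show "\<exists>U. open U \<and> r \<in> U \<and> ecarrier \<inter> proj -` U \<subseteq> \<Union>\<K>" by blast
  next
    fix g assume g: "g \<in> Z" "Inl g \<in> \<Union>\<K>"
    then obtain K where K': "K \<in> \<K>" "Inl g \<in> K" by blast
    then have "eopen K" using K by blast
    from eopen_at_Z[OF this g(1) K'(2)] obtain N where "tail g N \<subseteq> K"
      by blast
    with K' show "\<exists>N. tail g N \<subseteq> \<Union>\<K>" by blast
  qed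
qed

lemma openin_etop: "openin etop W \<longleftrightarrow> eopen W"
  by (simp add: etop_def istopology_eopen)

lemma eopen_ecarrier: "eopen ecarrier"
  unfolding eopen_def using tail_ecarrier by (auto intro: exI[of _ UNIV])

lemma topspace_etop [simp]: "topspace etop = ecarrier"
  using eopen_ecarrier by (auto simp: topspace_def openin_etop eopen_def)

text \<open>All of \<open>tail g 0\<close> projects to \<open>g\<close>, so over \<open>Z\<close>
  the condition holds with any bound.\<close>

lemma eopen_proj: "open U \<Longrightarrow> eopen (ecarrier \<inter> proj -` U)"
  unfolding eopen_def by (auto simp: tail_def ecarrier_def intro!: exI[of _ U])

lemma eopen_Inr: "eopen {Inr z}"
  by (auto simp: eopen_def ecarrier_def)

text \<open>Isolated points are clopen: points of \<open>R\<close> have neighbourhoods missing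
  \<open>deg z\<close>, and tails above \<open>height z\<close> miss \<open>z\<close>.\<close>

lemma eopen_compl_Inr: "eopen (ecarrier - {Inr z})"
  unfolding eopen_def
proof (intro conjI ballI impI)
  fix r assume "r \<in> R"
  then have "r \<noteq> deg z" using Z_not_R deg_in_Z by blast
  then show "\<exists>U. open U \<and> r \<in> U \<and> ecarrier \<inter> proj -` U \<subseteq> ecarrier - {Inr z}"
    by (intro exI[of _ "- {deg z}"]) auto
next
  fix g
  have "tail g (Suc (height z)) \<subseteq> ecarrier - {Inr z}"
    by (auto simp: tail_def ecarrier_def)
  then show "\<exists>N. tail g N \<subseteq> ecarrier - {Inr z}" ..
qed auto

lemma eopen_tail: "g \<in> Z \<Longrightarrow> eopen (insert (Inl g) (tail g N))"
  using Z_not_R by (auto simp: eopen_def ecarrier_def tail_def)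

text \<open>Together with \<open>eopen_tail\<close> this gives points over \<open>Z\<close> a base
  of clopen neighbourhoods. A point of \<open>R\<close> avoids the whole fibre over
  \<open>g\<close>, and tails over other points are disjoint from it.\<close>

lemma eopen_compl_tail:
  assumes g: "g \<in> Z"
  shows "eopen (ecarrier - insert (Inl g) (tail g N))"
  unfolding eopen_def
proof (intro conjI ballI impI)
  fix r assume "r \<in> R"
  then have "r \<noteq> g" using Z_not_R g by blast
  then show "\<exists>U. open U \<and> r \<in> U \<and> ecarrier \<inter> proj -` U \<subseteq> ecarrier - insert (Inl g) (tail g N)"
    by (intro exI[of _ "- {g}"]) (auto simp: tail_def)
next
  fix h assume "Inl h \<in> ecarrier - insert (Inl g) (tail g N)"
  then have "h \<noteq> g" by auto
  then have "tail h 0 \<subseteq> ecarrier - insert (Inl g) (tail g N)"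
    by (auto simp: tail_def ecarrier_def)
  then show "\<exists>M. tail h M \<subseteq> ecarrier - insert (Inl g) (tail g N)" ..
qed auto

lemma ecarrier_cases:
  assumes "p \<in> ecarrier"
  obtains (remainder) r where "r \<in> R" "p = Inl r" | (limit) g where "g \<in> Z" "p = Inl g"
    | (isolated) z where "p = Inr z"
  using assms by (auto simp: ecarrier_def)

lemma continuous_proj: "continuous_map etop euclidean proj"
  unfolding continuous_map_def
proof (intro conjI allI impI)
  fix U :: "'a set" assume "openin euclidean U"
  then show "openin etop {p \<in> topspace etop. proj p \<in> U}"
    using eopen_proj[of U] by (simp add: openin_etop vimage_def Int_def)
qed auto

text \<open>Over \<open>R\<close> a separating function on the group is composed with
  \<open>proj\<close>; all other points have small clopen neighbourhoods.\<close>

lemma completely_regular_etop: "completely_regular_space etop"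
  unfolding completely_regular_space_alt'
proof (intro allI impI)
  fix W p assume W: "openin etop W" and p: "p \<in> W"
  have clopen: "\<exists>f. continuous_map etop euclideanreal f \<and> f p = 0 \<and> f ` (topspace etop - W) \<subseteq> {1}"
    if "eopen B" "eopen (ecarrier - B)" "p \<in> B" "B \<subseteq> W" for B
    using clopen_separating_function[of etop B] that
    by (intro exI[of _ "\<lambda>q. if q \<in> B then 0 else 1"]) (auto simp: openin_etop)
  have "p \<in> ecarrier" using W p openin_subset by fastforce
  then show "\<exists>f. continuous_map etop euclideanreal f \<and> f p = 0 \<and> f ` (topspace etop - W) \<subseteq> {1}"
  proof (cases rule: ecarrier_cases)
    case (remainder r)
    then obtain U where U: "open U" "r \<in> U" "ecarrier \<inter> proj -` U \<subseteq> W"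
      using W p eopen_at_R[of W r] unfolding openin_etop by blast
    obtain f :: "'a \<Rightarrow> real" where f: "continuous_on UNIV f" "f r = 0" "\<And>y. y \<notin> U \<Longrightarrow> f y = 1"
      using topological_group_urysohn_at[OF U(1,2)] by blast
    have "continuous_map etop euclideanreal (f \<circ> proj)"
      using continuous_proj f(1) by (intro continuous_map_compose[of _ euclidean]) auto
    then show ?thesis
      using remainder f U(3) by (intro exI[of _ "f \<circ> proj"]) auto
  next
    case (limit g)
    then obtain N where "tail g N \<subseteq> W"
      using W p eopen_at_Z[of W g] unfolding openin_etop by blast
    then show ?thesis
      using limit p by (intro clopen[OF eopen_tail eopen_compl_tail]) auto
  next
    case (isolated z)
    then show ?thesis
      using p by (intro clopen[OF eopen_Inr eopen_compl_Inr]) auto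
  qed
qed

lemma t1_etop: "t1_space etop"
  unfolding t1_space_closedin_singleton
proof
  fix p assume "p \<in> topspace etop"
  then have p: "p \<in> ecarrier" by simp
  then have "eopen (ecarrier - {p})"
  proof (cases rule: ecarrier_cases)
    case (remainder r)
    then have "Inr z \<in> ecarrier \<inter> proj -` (- {r})" for z
      using Z_not_R deg_in_Z by (auto simp: ecarrier_def)
    then have "ecarrier - {p} = ecarrier \<inter> proj -` (- {r})"
      using remainder by (auto elim!: ecarrier_cases)
    then show ?thesis using eopen_proj[of "- {r}"] by auto
  next
    case (limit g)
    have "ecarrier - {p} = (ecarrier - insert (Inl g) (tail g 0)) \<union> range Inr"
      using limit by (auto simp: ecarrier_def tail_def)
    moreover have "eopen (range Inr)"
      by (auto simp: eopen_def ecarrier_def)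
    ultimately show ?thesis
      using eopen_compl_tail[OF limit(1), of 0] by (metis openin_Un openin_etop)
  next
    case (isolated z)
    then show ?thesis using eopen_compl_Inr by simp
  qed
  then show "closedin etop {p}"
    using p by (simp add: closedin_def openin_etop)
qed

text \<open>This and the next two estimates give continuity over \<open>Z\<close>: a product has
  large height when both factors do, or when one does and the other is fixed.\<close>

lemma height_bicyclic_mult: "min (height z) (height w) \<le> height (bicyclic_mult z w)"
  by (cases z; cases w) (auto simp: height_def)

lemma height_bicyclic_mult_left: "height z \<le> height (bicyclic_mult z w) + fst w"
  by (cases z; cases w) (auto simp: height_def)

lemma height_bicyclic_mult_right: "height w \<le> height (bicyclic_mult z w) + snd z"
  by (cases z; cases w) (auto simp: height_def)

text \<open>If the product projects into \<open>R\<close>, some factor is a group element and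
  neighbourhoods are pulled back from continuity of addition. Otherwise both factors project into
  \<open>Z\<close>, because \<open>R\<close> absorbs sums with \<open>R\<close> and
  \<open>Z\<close>, and the height estimates apply.\<close>

lemma continuous_emult: "continuous_map (prod_topology etop etop) etop (\<lambda>(p, q). emult p q)"
  unfolding continuous_map_def
proof (intro conjI allI impI)
  show "(\<lambda>(p, q). emult p q) \<in> topspace (prod_topology etop etop) \<rightarrow> topspace etop"
    using emult_ecarrier by auto
  fix W assume "openin etop W"
  then have W: "eopen W" by (simp add: openin_etop)
  show "openin (prod_topology etop etop) {pq \<in> topspace (prod_topology etop etop). (case pq of (p, q) \<Rightarrow> emult p q) \<in> W}"
    unfolding openin_prod_topology_alt
  proof (intro allI impI)
    fix p q assume "(p, q) \<in> {pq \<in> topspace (prod_topology etop etop). (case pq of (p, q) \<Rightarrow> emult p q) \<in> W}"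
    then have pq: "p \<in> ecarrier" "q \<in> ecarrier" "emult p q \<in> W" by auto
    have "\<exists>A B. eopen A \<and> eopen B \<and> p \<in> A \<and> q \<in> B \<and> (\<forall>a\<in>A. \<forall>b\<in>B. emult a b \<in> W)"
    proof (cases "proj p + proj q \<in> R")
      case True
      have "p \<in> range Inl \<or> q \<in> range Inl"
      proof (rule ccontr)
        assume "\<not> ?thesis"
        then obtain z w where "p = Inr z" "q = Inr w"
          by (metis rangeI sum.exhaust)
        then have "proj p + proj q \<in> Z" using Z_add by simp
        with True show False using Z_not_R by blast
      qed
      then have "Inl (proj p + proj q) \<in> W" using pq emult_eq_Inl by metis
      then obtain U where U: "open U" "proj p + proj q \<in> U" "ecarrier \<inter> proj -` U \<subseteq> W"
        using eopen_at_R[OF W True] by blast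
      have "eventually (\<lambda>v. v \<in> U) (nhds (proj p + proj q))"
        using U by (auto simp: eventually_nhds)
      then have "eventually (\<lambda>v. fst v + snd v \<in> U) (nhds (proj p) \<times>\<^sub>F nhds (proj q))"
        using tendsto_add_Pair filterlim_iff by fast
      then obtain P Q where PQ: "eventually P (nhds (proj p))" "eventually Q (nhds (proj q))"
        "\<And>a b. P a \<Longrightarrow> Q b \<Longrightarrow> a + b \<in> U"
        unfolding eventually_prod_filter by auto
      then obtain A B where AB: "open A" "proj p \<in> A" "\<forall>a\<in>A. P a" "open B" "proj q \<in> B" "\<forall>b\<in>B. Q b"
        unfolding eventually_nhds by blast
      show ?thesis
      proof (intro exI conjI ballI)
        show "eopen (ecarrier \<inter> proj -` A)" "eopen (ecarrier \<inter> proj -` B)" using AB eopen_proj by auto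
        show "p \<in> ecarrier \<inter> proj -` A" "q \<in> ecarrier \<inter> proj -` B" using AB pq by auto
        fix a b assume "a \<in> ecarrier \<inter> proj -` A" "b \<in> ecarrier \<inter> proj -` B"
        then show "emult a b \<in> W"
          using U(3) AB PQ(3) emult_ecarrier by (auto intro!: subsetD[OF U(3)])
      qed
    next
      case False
      then have pZ: "proj p \<in> Z" "proj q \<in> Z"
        using proj_ecarrier[OF pq(1)] proj_ecarrier[OF pq(2)] R_add R_add_Z by (metis Un_iff add.commute)+
      have tailW: "\<exists>N. tail (proj p + proj q) N \<subseteq> W" if "Inl (proj p + proj q) \<in> W"
        using eopen_at_Z[OF W Z_add[OF pZ] that] by blast
      have inW: "Inr z \<in> W" if "tail g N \<subseteq> W" "deg z = g" "N \<le> height z" for g N z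
        using that by (auto simp: tail_def)
      show ?thesis
      proof (cases p; cases q)
        fix z w assume "p = Inr z" "q = Inr w"
        then show ?thesis
          using pq by (intro exI[of _ "{p}"] exI[of _ "{q}"]) (simp add: eopen_Inr)
      next
        fix g w assume [simp]: "p = Inl g" "q = Inr w"
        obtain N where N: "tail (g + deg w) N \<subseteq> W" using tailW pq by auto
        \<comment> \<open>Right multiplication by \<open>w\<close> lowers the height by at most
          \<open>fst w\<close>, hence the shifted start of the tail.\<close>
        have "emult a b \<in> W" if "a \<in> insert (Inl g) (tail g (N + fst w))" "b \<in> {Inr w}" for a b
        proof -
          have "Inr (bicyclic_mult z w) \<in> W" if "deg z = g" "N + fst w \<le> height z" for z
            using height_bicyclic_mult_left[of z w] that
            by (intro inW[OF N]) (simp_all add: deg_bicyclic_mult)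
          then show ?thesis using that pq(3) by (auto simp: tail_def)
        qed
        then show ?thesis
          using pZ by (intro exI[of _ "insert (Inl g) (tail g (N + fst w))"] exI[of _ "{Inr w}"])
            (simp add: eopen_Inr eopen_tail)
      next
        fix z h assume [simp]: "p = Inr z" "q = Inl h"
        obtain N where N: "tail (deg z + h) N \<subseteq> W" using tailW pq by auto
        have "emult a b \<in> W" if "a \<in> {Inr z}" "b \<in> insert (Inl h) (tail h (N + snd z))" for a b
        proof -
          have "Inr (bicyclic_mult z w) \<in> W" if "deg w = h" "N + snd z \<le> height w" for w
            using height_bicyclic_mult_right[of w z] that
            by (intro inW[OF N]) (simp_all add: deg_bicyclic_mult)
          then show ?thesis using that pq(3) by (auto simp: tail_def)
        qed
        then show ?thesis
          using pZ by (intro exI[of _ "{Inr z}"] exI[of _ "insert (Inl h) (tail h (N + snd z))"])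
            (simp add: eopen_Inr eopen_tail)
      next
        fix g h assume [simp]: "p = Inl g" "q = Inl h"
        obtain N where N: "tail (g + h) N \<subseteq> W" using tailW pq by auto
        have "emult a b \<in> W" if "a \<in> insert (Inl g) (tail g N)" "b \<in> insert (Inl h) (tail h N)" for a b
        proof -
          have "Inr (bicyclic_mult z w) \<in> W" if "deg z = g" "deg w = h" "N \<le> height z" "N \<le> height w" for z w
            using height_bicyclic_mult[of z w] that
            by (intro inW[OF N]) (simp_all add: deg_bicyclic_mult)
          then show ?thesis using that pq(3) by (auto simp: tail_def)
        qed
        then show ?thesis
          using pZ by (intro exI[of _ "insert (Inl g) (tail g N)"] exI[of _ "insert (Inl h) (tail h N)"])
            (simp add: eopen_tail)
      qed
    qed
    then obtain A B where AB: "eopen A" "eopen B" "p \<in> A" "q \<in> B" "\<And>a b. a \<in> A \<Longrightarrow> b \<in> B \<Longrightarrow> emult a b \<in> W" by blast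
    then have "A \<subseteq> ecarrier" "B \<subseteq> ecarrier" by (auto simp: eopen_def)
    then show "\<exists>A B. openin etop A \<and> openin etop B \<and> p \<in> A \<and> q \<in> B \<and>
        A \<times> B \<subseteq> {pq \<in> topspace (prod_topology etop etop). (case pq of (p, q) \<Rightarrow> emult p q) \<in> W}"
      using AB by (intro exI[of _ A] exI[of _ B]) (auto simp: openin_etop)
  qed
qed

lemma topological_semigroup_etop: "topological_semigroup ecarrier emult etop"
  unfolding topological_semigroup_def
proof (intro conjI ballI)
  show "continuous_map (prod_topology etop etop) etop (\<lambda>(p, q). emult p q)"
    by (rule continuous_emult)
  show "emult p q \<in> ecarrier" if "p \<in> ecarrier" "q \<in> ecarrier" for p q
    using that by (rule emult_ecarrier)
qed (rule topspace_etop emult_assoc)+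

text \<open>If the projections take infinitely many values, they have a limit point in
  \<open>R\<close>, where neighbourhoods come from the group. Otherwise infinitely many terms share
  a projection \<open>g\<close>; either some value recurs infinitely often, or the terms leave every
  finite low part of the fibre and cluster at \<open>Inl g\<close>.\<close>

lemma countably_compact_etop: "countably_compact_space etop"
proof (rule countably_compact_space_if_cluster)
  fix s :: "nat \<Rightarrow> 'a + nat \<times> nat"
  assume s: "range s \<subseteq> topspace etop"
  show "\<exists>p\<in>topspace etop. \<forall>W. openin etop W \<and> p \<in> W \<longrightarrow> infinite {n. s n \<in> W}"
  proof (cases "finite (range (proj \<circ> s))")
    case False
    have "Z = range (\<lambda>(i, j). nmul i x - nmul j x)"
      unfolding Z_def deg_def by (simp add: split_beta)
    moreover have "(proj \<circ> s) n \<in> R \<union> Z" for n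
      using proj_ecarrier[of "s n"] s by (simp add: image_subset_iff)
    ultimately have "range (proj \<circ> s) \<subseteq> R \<union> range (\<lambda>(i, j). nmul i x - nmul j x)"
      by blast
    then obtain l where l: "l \<in> R" "l islimpt range (proj \<circ> s)"
      using R_acc False by blast
    have "infinite {n. s n \<in> W}" if W: "openin etop W" "Inl l \<in> W" for W
    proof
      assume fin: "finite {n. s n \<in> W}"
      obtain U where U: "open U" "l \<in> U" "ecarrier \<inter> proj -` U \<subseteq> W"
        using W l(1) eopen_at_R[of W l] unfolding openin_etop by blast
      have "range (proj \<circ> s) \<inter> U \<subseteq> (proj \<circ> s) ` {n. s n \<in> W}"
        using U(3) s by auto
      then have "finite (range (proj \<circ> s) \<inter> U)" using fin finite_surj by blast
      then show False
        using l(2) U by (auto simp: islimpt_eq_acc_point Int_commute)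
    qed
    then show ?thesis using l(1) by (intro bexI[of _ "Inl l"]) (auto simp: ecarrier_def)
  next
    case True
    then obtain n\<^sub>0 where "infinite {n. (proj \<circ> s) n = (proj \<circ> s) n\<^sub>0}"
      using pigeonhole_infinite[of UNIV "proj \<circ> s"] by auto
    then obtain g where g: "infinite {n. proj (s n) = g}" by auto
    show ?thesis
    proof (cases "\<exists>p. infinite {n. s n = p}")
      case True
      then obtain p where p: "infinite {n. s n = p}" by blast
      then obtain n where "s n = p" using infinite_imp_nonempty by blast
      then have "p \<in> topspace etop" using s by blast
      moreover have "infinite {n. s n \<in> W}" if "p \<in> W" for W
        by (rule infinite_super[OF _ p]) (use that in auto)
      ultimately show ?thesis by blast
    next
      case False
      have fin: "finite {n. s n \<in> F}" if "finite F" for F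
      proof -
        have "{n. s n \<in> F} = (\<Union>p\<in>F. {n. s n = p})" by auto
        then show ?thesis using that False by simp
      qed
      have "infinite ({n. proj (s n) = g} - {n. s n \<in> {Inl g}})"
        using g fin[of "{Inl g}"] by (intro Diff_infinite_finite) auto
      then obtain n where n: "proj (s n) = g" "s n \<noteq> Inl g"
        using infinite_imp_nonempty by blast
      then have "g \<in> Z" by (cases "s n") auto
      moreover have "infinite {n. s n \<in> W}" if W: "openin etop W" "Inl g \<in> W" for W
      proof -
        obtain N where N: "tail g N \<subseteq> W"
          using W \<open>g \<in> Z\<close> eopen_at_Z[of W g] unfolding openin_etop by blast
        have "infinite ({n. proj (s n) = g} - {n. s n \<in> Inr ` {z. deg z = g \<and> height z < N}})"
          using g fin[OF finite_imageI[OF finite_low_fibre]] by (intro Diff_infinite_finite) auto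
        moreover have "s n \<in> W"
          if "proj (s n) = g" "s n \<notin> Inr ` {z. deg z = g \<and> height z < N}" for n
        proof (cases "s n")
          case (Inl h)
          then show ?thesis using that(1) W(2) by simp
        next
          case (Inr z)
          then have "deg z = g" "N \<le> height z" using that by (force simp: not_le)+
          then show ?thesis using N Inr by (auto simp: tail_def)
        qed
        ultimately show ?thesis
          by (elim infinite_super[rotated]) auto
      qed
      ultimately show ?thesis
        by (intro bexI[of _ "Inl g"]) (auto simp: ecarrier_def)
    qed
  qed
qed

end

section \<open>Transport along an injection\<close>

lemma homeomorphic_countably_compact_space:
  assumes hom: "homeomorphic_maps X Y \<phi> \<psi>" and X: "countably_compact_space X"
  shows "countably_compact_space Y"
  unfolding countably_compact_space_def
proof (intro allI impI)
  fix \<U> assume \<U>: "countable \<U> \<and> (\<forall>u\<in>\<U>. openin Y u) \<and> topspace Y \<subseteq> \<Union>\<U>"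
  have \<phi>: "continuous_map X Y \<phi>" and \<psi>: "continuous_map Y X \<psi>" and inv: "\<And>y. y \<in> topspace Y \<Longrightarrow> \<phi> (\<psi> y) = y"
    using hom by (auto simp: homeomorphic_maps_def)
  have \<phi>Y: "\<phi> p \<in> topspace Y" if "p \<in> topspace X" for p
    using continuous_map_image_subset_topspace[OF \<phi>] that by blast
  have \<psi>X: "\<psi> q \<in> topspace X" if "q \<in> topspace Y" for q
    using continuous_map_image_subset_topspace[OF \<psi>] that by blast
  define pre where "pre u = {p \<in> topspace X. \<phi> p \<in> u}" for u
  have "countable (pre ` \<U>) \<and> (\<forall>u\<in>pre ` \<U>. openin X u) \<and> topspace X \<subseteq> \<Union>(pre ` \<U>)"
  proof (intro conjI ballI subsetI)
    fix v assume "v \<in> pre ` \<U>"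
    then show "openin X v"
      using \<U> openin_continuous_map_preimage[OF \<phi>] by (auto simp: pre_def)
  next
    fix p assume "p \<in> topspace X"
    then show "p \<in> \<Union>(pre ` \<U>)"
      using \<phi>Y[of p] \<U> by (auto simp: pre_def)
  qed (use \<U> in auto)
  then obtain F where F: "F \<subseteq> pre ` \<U>" "finite F" "topspace X \<subseteq> \<Union>F"
    using X unfolding countably_compact_space_def by meson
  then obtain G where G: "G \<subseteq> \<U>" "finite G" "F = pre ` G"
    by (meson finite_subset_image)
  have "topspace Y \<subseteq> \<Union>G"
  proof
    fix q assume q: "q \<in> topspace Y"
    then have "\<psi> q \<in> \<Union>(pre ` G)" using F(3) G(3) \<psi>X by blast
    then show "q \<in> \<Union>G" using inv[OF q] by (auto simp: pre_def)
  qed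
  with G show "\<exists>F\<subseteq>\<U>. finite F \<and> topspace Y \<subseteq> \<Union>F" by blast
qed

text \<open>The image of \<phi> receives the topology pulled back along the inverse, which makes
  \<phi> a homeomorphism onto its image, so all properties carry over.\<close>

lemma transport_topological_semigroup:
  fixes \<phi> :: "'b \<Rightarrow> 'c"
  assumes \<phi>: "inj \<phi>" and sg: "topological_semigroup S f T"
    and ty: "tychonoff_space T" and cc: "countably_compact_space T"
  obtains S' f' T' where "topological_semigroup S' f' T'" "tychonoff_space T'"
    "countably_compact_space T'" "\<phi> ` S \<subseteq> S'" "\<And>a b. f' (\<phi> a) (\<phi> b) = \<phi> (f a b)"
proof -
  define \<psi> where "\<psi> = inv \<phi>"
  have \<psi>\<phi> [simp]: "\<psi> (\<phi> a) = a" for a using \<phi> by (simp add: \<psi>_def)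
  define T' where "T' = pullback_topology (range \<phi>) \<psi> T"
  define f' where "f' a b = \<phi> (f (\<psi> a) (\<psi> b))" for a b
  have S: "topspace T = S" and closed: "\<And>a b. a \<in> S \<Longrightarrow> b \<in> S \<Longrightarrow> f a b \<in> S"
    and assoc: "\<And>a b c. a \<in> S \<Longrightarrow> b \<in> S \<Longrightarrow> c \<in> S \<Longrightarrow> f (f a b) c = f a (f b c)"
    and cont: "continuous_map (prod_topology T T) T (\<lambda>(a, b). f a b)"
    using sg by (auto simp: topological_semigroup_def)
  have S': "topspace T' = \<phi> ` S"
    by (auto simp: T'_def topspace_pullback_topology S)
  have "continuous_map T T (\<psi> \<circ> \<phi>)"
    by (rule continuous_map_eq[OF continuous_map_id]) auto
  then have c\<phi>: "continuous_map T T' \<phi>"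
    unfolding T'_def by (rule continuous_map_pullback') auto
  have c\<psi>: "continuous_map T' T \<psi>"
    using continuous_map_pullback[OF continuous_map_id, of "range \<phi>" \<psi> T] by (simp add: T'_def)
  have hom: "homeomorphic_maps T T' \<phi> \<psi>"
    using c\<phi> c\<psi> by (auto simp: homeomorphic_maps_def S')
  have "continuous_map (prod_topology T' T') (prod_topology T T) (\<lambda>(a, b). (\<psi> a, \<psi> b))"
    using c\<psi> by (simp add: continuous_map_prod_top)
  from continuous_map_compose[OF continuous_map_compose[OF this cont] c\<phi>]
  have "continuous_map (prod_topology T' T') T' (\<lambda>(a, b). f' a b)"
    by (simp add: f'_def o_def case_prod_unfold)
  then have "topological_semigroup (\<phi> ` S) f' T'"
    by (auto simp: topological_semigroup_def S' f'_def closed assoc)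
  moreover have "T homeomorphic_space T'"
    using hom unfolding homeomorphic_space_def by blast
  then have "tychonoff_space T'"
    using ty homeomorphic_completely_regular_space homeomorphic_t1_space
    unfolding tychonoff_space_def by blast
  ultimately show ?thesis
    using homeomorphic_countably_compact_space[OF hom cc] by (intro that) (auto simp: f'_def)
qed

theorem theorem6p6:
  assumes "torsion_free TYPE('g::{topological_ab_group_add, t2_space})"
    and "\<exists>x::'g. x \<noteq> 0"
    and "countably_compact (UNIV :: 'g set)"
    and "\<And>s :: nat \<Rightarrow> 'g. \<not> nontrivial_convergent_seq s"
  shows "\<exists>(S :: 'g set set set) (f :: 'g set set \<Rightarrow> 'g set set \<Rightarrow> 'g set set) T.
           topological_semigroup S f T \<and> tychonoff_space T \<and> countably_compact_space T \<and>
           (\<exists>h :: nat \<times> nat \<Rightarrow> 'g set set. inj h \<and> range h \<subseteq> S \<and>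
               (\<forall>x y. h (bicyclic_mult x y) = f (h x) (h y)))"
proof -
  obtain x :: 'g where x: "x \<noteq> 0" using assms(2) by blast
  have inj: "inj (\<lambda>n. nmul n x)"
    by (rule torsion_free_inj_nmul[OF assms(1) x])
  obtain R :: "'g set" where R: "\<And>a b. \<lbrakk>a \<in> R; b \<in> R\<rbrakk> \<Longrightarrow> a + b \<in> R"
    "\<And>a i j. a \<in> R \<Longrightarrow> a + (nmul i x - nmul j x) \<in> R"
    "\<And>i j. nmul i x - nmul j x \<notin> R"
    "\<And>A. \<lbrakk>infinite A; A \<subseteq> R \<union> range (\<lambda>(i, j). nmul i x - nmul j x)\<rbrakk> \<Longrightarrow> \<exists>l\<in>R. l islimpt A"
    using countably_compact_ideal[OF assms(1) x assms(3,4)] by metis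
  interpret bicyclic_extension x R
    by unfold_locales (fact inj R)+
  \<comment> \<open>The disjoint union is embedded into the type demanded for the carrier: group
    elements become one-element families, pairs become two-element families. The latter are distinct
    because \<open>x\<close> has infinite order.\<close>
  define \<phi> :: "'g + nat \<times> nat \<Rightarrow> 'g set set" where
    "\<phi> = case_sum (\<lambda>g. {{g}}) (\<lambda>z. {{}, {nmul (prod_encode z) x}})"
  have "inj \<phi>"
  proof (rule injI)
    fix p q assume "\<phi> p = \<phi> q"
    then show "p = q"
      using inj by (cases p; cases q) (auto simp: \<phi>_def doubleton_eq_iff dest: injD)
  qed
  have ty: "tychonoff_space etop"
    using completely_regular_etop t1_etop by (simp add: tychonoff_space_def)
  obtain S f T where T: "topological_semigroup S f T" "tychonoff_space T" "countably_compact_space T"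
    and \<phi>: "\<phi> ` ecarrier \<subseteq> S" "\<And>a b. f (\<phi> a) (\<phi> b) = \<phi> (emult a b)"
    by (rule transport_topological_semigroup[OF \<open>inj \<phi>\<close> topological_semigroup_etop ty countably_compact_etop])
      (rule that, assumption+)
  have "inj (\<phi> \<circ> Inr) \<and> range (\<phi> \<circ> Inr) \<subseteq> S \<and>
      (\<forall>z w. (\<phi> \<circ> Inr) (bicyclic_mult z w) = f ((\<phi> \<circ> Inr) z) ((\<phi> \<circ> Inr) w))"
  proof (intro conjI allI)
    show "inj (\<phi> \<circ> Inr)" using \<open>inj \<phi>\<close> by (simp add: inj_compose)
    show "range (\<phi> \<circ> Inr) \<subseteq> S" using \<phi>(1) by (auto simp: ecarrier_def)
  qed (simp add: \<phi>(2))
  with T show ?thesis by blast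
qed

end
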